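(* Up to isomorphism, there are exactly $13$ centrally nilpotent right Bol loops of order $3^3$, exactly $15$ of order $5^3$, and exactly $17$ of order $7^3$.
   Context: A loop is a set with a binary multiplication and a two-sided identity $1$ in which all left and right translations are bijections. A loop is right Bol if it satisfies $((xy)z)y=x((yz)y)$ for all $x,y,z$. The center $Z(Q)$ is the set of elements $x$ with $x\cdot yz=xy\cdot z$, $y\cdot xz=yx\cdot z$, $y\cdot zx=yz\cdot x$ and $xy=yx$ for all $y,z\in Q$; it is a normal subloop. $Q$ is centrally nilpotent if the series $Q,\ Q/Z(Q),\ (Q/Z(Q))/Z(Q/Z(Q)),\dots$ reaches the trivial loop after finitely many steps. *)

theory Defs
  imports Main
begin

definition is_loop :: "'a set \<Rightarrow> ('a \<Rightarrow> 'a \<Rightarrow> 'a) \<Rightarrow> bool" where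
  "is_loop A m \<longleftrightarrow>
     (\<forall>x\<in>A. \<forall>y\<in>A. m x y \<in> A) \<and>
     (\<exists>e\<in>A. \<forall>x\<in>A. m e x = x \<and> m x e = x) \<and>
     (\<forall>a\<in>A. bij_betw (\<lambda>x. m a x) A A \<and> bij_betw (\<lambda>x. m x a) A A)"

definition right_bol :: "'a set \<Rightarrow> ('a \<Rightarrow> 'a \<Rightarrow> 'a) \<Rightarrow> bool" where
  "right_bol A m \<longleftrightarrow>
     (\<forall>x\<in>A. \<forall>y\<in>A. \<forall>z\<in>A. m (m (m x y) z) y = m x (m (m y z) y))"

text \<open>Quotients of the loop (A,m) are represented by congruences theta on A
  (equivalence relations on A); the quotient loop is A/theta.
  central_mod A m theta x: the class of x lies in the center Z(A/theta).\<close>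
definition central_mod :: "'a set \<Rightarrow> ('a \<Rightarrow> 'a \<Rightarrow> 'a) \<Rightarrow> 'a rel \<Rightarrow> 'a \<Rightarrow> bool" where
  "central_mod A m \<theta> x \<longleftrightarrow> x \<in> A \<and>
     (\<forall>y\<in>A. \<forall>z\<in>A.
        (m x (m y z), m (m x y) z) \<in> \<theta> \<and>
        (m y (m x z), m (m y x) z) \<in> \<theta> \<and>
        (m y (m z x), m (m y z) x) \<in> \<theta> \<and>
        (m x y, m y x) \<in> \<theta>)"

text \<open>Given the congruence theta (quotient A/theta), the congruence describing the
  quotient (A/theta)/Z(A/theta): two elements are related iff their classes lie in
  the same coset of the center Z(A/theta), i.e. [x] = [y][c] with [c] central.\<close>
definition next_cong :: "'a set \<Rightarrow> ('a \<Rightarrow> 'a \<Rightarrow> 'a) \<Rightarrow> 'a rel \<Rightarrow> 'a rel" where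
  "next_cong A m \<theta> = {(x, y). x \<in> A \<and> y \<in> A \<and>
      (\<exists>c. central_mod A m \<theta> c \<and> (x, m y c) \<in> \<theta>)}"

text \<open>Centrally nilpotent: the series Q, Q/Z(Q), ... reaches the trivial loop,
  i.e. the k-th congruence is all of A x A.\<close>
definition centrally_nilpotent :: "'a set \<Rightarrow> ('a \<Rightarrow> 'a \<Rightarrow> 'a) \<Rightarrow> bool" where
  "centrally_nilpotent A m \<longleftrightarrow> (\<exists>k. (next_cong A m ^^ k) (Id_on A) = A \<times> A)"

definition loop_iso :: "'a set \<Rightarrow> ('a \<Rightarrow> 'a \<Rightarrow> 'a) \<Rightarrow> 'b set \<Rightarrow> ('b \<Rightarrow> 'b \<Rightarrow> 'b) \<Rightarrow> bool" where
  "loop_iso A m B m' \<longleftrightarrow> (\<exists>f. bij_betw f A B \<and> (\<forall>x\<in>A. \<forall>y\<in>A. f (m x y) = m' (f x) (f y)))"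

text \<open>All centrally nilpotent right Bol loops of order n, realised on the carrier
  {..<n} (every loop of order n is isomorphic to one of these); tables are
  normalised to 0 outside the carrier.\<close>
definition cn_bol_loops :: "nat \<Rightarrow> (nat \<Rightarrow> nat \<Rightarrow> nat) set" where
  "cn_bol_loops n = {m. is_loop {..<n} m \<and> right_bol {..<n} m \<and>
      centrally_nilpotent {..<n} m \<and>
      (\<forall>x y. x \<notin> {..<n} \<or> y \<notin> {..<n} \<longrightarrow> m x y = 0)}"

definition loop_iso_rel :: "nat \<Rightarrow> ((nat \<Rightarrow> nat \<Rightarrow> nat) \<times> (nat \<Rightarrow> nat \<Rightarrow> nat)) set" where
  "loop_iso_rel n = {(m, m'). m \<in> cn_bol_loops n \<and> m' \<in> cn_bol_loops n \<and>
      loop_iso {..<n} m {..<n} m'}"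

definition num_cn_bol_loops :: "nat \<Rightarrow> nat" where
  "num_cn_bol_loops n = card (cn_bol_loops n // loop_iso_rel n)"

end

theory Submission
  imports Defs "Berlekamp_Zassenhaus.Finite_Field" "HOL-Library.Product_Plus"
begin

text \<open>Let \<open>p\<close> be an odd prime; the count is \<open>p + 10\<close>.  A centrally nilpotent right Bol loop
  of order \<open>p^3\<close> is either cyclic or a central extension of \<open>F_p^2\<close> by \<open>F_p\<close>, hence given by a
  cocycle \<open>\<theta>\<close> satisfying the Bol identity.  Right power alternativity lets one choose the
  section so that \<open>\<theta> x (t, 0)\<close> is a multiple of the carry cocycle.  After subtracting it, the
  Bol identity forces \<open>\<theta>\<close> to be quadratic in the first coordinate, which leaves five parameters
  modulo coboundaries.  The cohomology class is determined by the commutator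
  \<open>\<theta> x y - \<theta> y x\<close>, which equals \<open>det(x, y) (\<omega>(x + y) + g)\<close> for a linear form \<open>\<omega>\<close>, together
  with the \<open>p\<close>-th power map.  Outside the abelian case the central \<open>F_p\<close> is the commutant,
  so isomorphism classes are orbits of \<open>GL_2(F_p) \<times> F_p^*\<close> on these invariants.\<close>

section \<open>Residues modulo a prime\<close>

text \<open>The cyclic group is exceptional because none of its quotients is \<open>F_p^2\<close>.
  Every other loop with a cyclic quotient of order \<open>p^2\<close> turns out to be
  \<open>Z/p^2 x Z/p\<close>, which can be rewritten over \<open>F_p^2\<close>.

  The obstacle is that carry cocycles do not transform visibly under a linear change of basis. Hence
  no such computation is made on cocycles: a pulled-back cocycle is again Bol, so it is cohomologous
  to some member of the five-parameter family, and its parameters are read off from the two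
  invariants, which ignore coboundaries.

  The commutator is bilinear only for \<open>\<omega> = 0\<close>, so \<open>\<omega>\<close>
  measures nonassociativity. With \<open>\<omega>\<close> normalized, what remains is
  \<open>g\<close>, one power coefficient \<open>c\<close> and a parameter \<open>t\<close>. If
  \<open>g\<close> can be scaled to 1, no freedom to rescale \<open>t\<close> is left, which
  accounts for the summand p; if \<open>g = 0\<close>, then \<open>t\<close> counts modulo squares.
  The total is 1 (cyclic) + 4 (\<open>\<omega> = 0\<close>) + p + 3 + 2.

  For \<open>p = 3\<close> the p-th power map acquires a cubic term. The constant \<open>eps\<close>
  weights it, and \<open>eps * x^3 = eps * x\<close> lets all odd primes be treated alike.\<close>

definition rep :: "'p::prime_card mod_ring \<Rightarrow> nat" where
  "rep x = nat (to_int_mod_ring x)"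

lemma of_nat_eq_mod_iff:
  "(of_nat m :: 'p::prime_card mod_ring) = of_nat n \<longleftrightarrow> m mod CARD('p) = n mod CARD('p)"
  using of_nat_eq_iff_cong_CHAR[where 'a = "'p mod_ring", of m n] by (simp add: cong_def)

lemma rep_less: "rep (x :: 'p::prime_card mod_ring) < CARD('p)"
proof -
  have "to_int_mod_ring x \<in> {0..<int CARD('p)}"
    by (metis range_to_int_mod_ring rangeI)
  then show ?thesis by (auto simp: rep_def nat_less_iff)
qed

lemma of_nat_rep [simp]: "of_nat (rep x) = (x :: 'p::prime_card mod_ring)"
proof -
  have "to_int_mod_ring x \<in> {0..<int CARD('p)}"
    by (metis range_to_int_mod_ring rangeI)
  then show ?thesis by (simp add: rep_def of_nat_of_int_mod_ring)
qed

lemma rep_of_nat: "rep (of_nat n :: 'p::prime_card mod_ring) = n mod CARD('p)"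
proof -
  have "(of_nat (rep (of_nat n :: 'p mod_ring)) :: 'p mod_ring) = of_nat n" by simp
  then show ?thesis
    by (metis mod_less of_nat_eq_mod_iff rep_less)
qed

lemma rep_0 [simp]: "rep (0 :: 'p::prime_card mod_ring) = 0"
  using rep_of_nat[of 0, where 'p = 'p] by simp

lemma rep_1 [simp]: "rep (1 :: 'p::prime_card mod_ring) = 1"
  using rep_of_nat[of 1, where 'p = 'p] one_mod_card[where 'a = 'p] by (simp del: of_nat_mod)

lemma rep_add: "rep (x + y) = (rep x + rep y) mod CARD('p)" for x y :: "'p::prime_card mod_ring"
  using rep_of_nat[of "rep x + rep y", where 'p = 'p] by simp

lemma rep_inj: "rep x = rep y \<longleftrightarrow> x = y" for x y :: "'p::prime_card mod_ring"
  by (metis of_nat_rep)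

lemma rep_eq_0_iff: "rep x = 0 \<longleftrightarrow> x = 0" for x :: "'p::prime_card mod_ring"
  by (metis rep_0 rep_inj)

lemma nat_induct_mod_ring:
  assumes "P 0" and "\<And>x. P x \<Longrightarrow> P (x + 1)"
  shows "P (x :: 'p::prime_card mod_ring)"
proof -
  have "P (of_nat n)" for n
  proof (induction n)
    case (Suc n)
    then show ?case using assms(2)[of "of_nat n"] by (simp add: add.commute)
  qed (use assms(1) in simp)
  then show ?thesis by (metis of_nat_rep)
qed

lemma additive_mod_ring:
  fixes f :: "'p::prime_card mod_ring \<Rightarrow> 'p mod_ring"
  assumes "\<And>x y. f (x + y) = f x + f y"
  shows "f x = f 1 * x"
proof (induction x rule: nat_induct_mod_ring)
  case 1
  have "f 0 = f 0 + f 0" using assms[of 0 0] by simp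
  then show ?case by (metis add_cancel_right_right mult_zero_right)
next
  case (2 x)
  then show ?case using assms[of x 1] by (simp add: algebra_simps)
qed

lemma two_neq_0: "CARD('p) > 2 \<Longrightarrow> (2 :: 'p::prime_card mod_ring) \<noteq> 0"
  using of_nat_eq_mod_iff[of 2 0, where 'p = 'p] by simp

text \<open>The cocycle of \<open>Z/p^2\<close> as an extension of \<open>Z/p\<close> by
  \<open>Z/p\<close>: the carry into the second base-p digit, read as a residue.\<close>

definition carry :: "'p::prime_card mod_ring \<Rightarrow> 'p mod_ring \<Rightarrow> 'p mod_ring" where
  "carry x y = of_nat ((rep x + rep y) div CARD('p))"

lemma rep_add_carry:
  "rep x + rep y = rep (x + y) + CARD('p) * ((rep x + rep y) div CARD('p))"
  for x y :: "'p::prime_card mod_ring"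
  by (simp add: rep_add)

lemma carry_0 [simp]: "carry x 0 = 0" "carry 0 x = 0" for x :: "'p::prime_card mod_ring"
  by (simp_all add: carry_def rep_less)

lemma carry_commute: "carry x y = carry y x" for x y :: "'p::prime_card mod_ring"
  by (simp add: carry_def add.commute)

text \<open>Either order of adding three digits produces the same total carry, namely the quotient
  of \<open>rep x + rep y + rep z\<close> by p.\<close>

lemma carry_cocycle: "carry x y + carry (x + y) z = carry y z + carry x (y + z)"
  for x y z :: "'p::prime_card mod_ring"
proof -
  let ?p = "CARD('p)"
  have pos: "?p > 0" by simp
  have "(rep x + rep y) div ?p + (rep (x + y) + rep z) div ?p = (rep x + rep y + rep z) div ?p"
  proof -
    have "(rep x + rep y + rep z) div ?p
        = (rep (x + y) + rep z + ?p * ((rep x + rep y) div ?p)) div ?p"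
      using rep_add_carry[of x y] by (metis add.commute add.left_commute)
    then show ?thesis using pos by simp
  qed
  moreover have "(rep y + rep z) div ?p + (rep x + rep (y + z)) div ?p = (rep x + rep y + rep z) div ?p"
  proof -
    have "(rep x + rep y + rep z) div ?p
        = (rep x + rep (y + z) + ?p * ((rep y + rep z) div ?p)) div ?p"
      using rep_add_carry[of y z] by (metis add.assoc)
    then show ?thesis using pos by simp
  qed
  ultimately show ?thesis unfolding carry_def of_nat_add[symmetric] by presburger
qed

text \<open>Add \<open>rep x\<close> to itself p times in base p: the last digit returns to 0, so
  \<open>p * rep x\<close> is p times the number of carries, and there are exactly
  \<open>rep x\<close> of them. Hence the carry cocycle has the identity as its p-th power
  map.\<close>

lemma sum_carry: "(\<Sum>i<CARD('p). carry (of_nat i * x) x) = x" for x :: "'p::prime_card mod_ring"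
proof -
  let ?p = "CARD('p)"
  have *: "n * rep x = rep (of_nat n * x) + ?p * (\<Sum>i<n. (rep (of_nat i * x) + rep x) div ?p)" for n
  proof (induction n)
    case (Suc n)
    have "rep (of_nat n * x) + rep x
        = rep (of_nat (Suc n) * x) + ?p * ((rep (of_nat n * x) + rep x) div ?p)"
      using rep_add_carry[of "of_nat n * x" x] by (simp add: algebra_simps)
    with Suc show ?case by (simp add: algebra_simps)
  qed simp
  have "?p * rep x = ?p * (\<Sum>i<?p. (rep (of_nat i * x) + rep x) div ?p)"
    using *[of ?p] by simp
  then have "rep x = (\<Sum>i<?p. (rep (of_nat i * x) + rep x) div ?p)"
    by simp
  then have "(of_nat (rep x) :: 'p mod_ring) = (\<Sum>i<?p. carry (of_nat i * x) x)"
    unfolding carry_def of_nat_sum[symmetric] by (rule arg_cong)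
  then show ?thesis by simp
qed

text \<open>This sum vanishes unless \<open>p = 3\<close>; it measures the failure of the
  \<open>p\<close>-th power map to be linear.\<close>

definition eps :: "'p::prime_card mod_ring" where
  "eps = (\<Sum>i<CARD('p). of_nat i * (of_nat i + 1))"

lemma sum_of_nat_mod_ring:
  assumes "CARD('p) > 2"
  shows "(\<Sum>i<CARD('p). of_nat i) = (0 :: 'p::prime_card mod_ring)"
proof -
  have "2 * (\<Sum>i<n. of_nat i) = of_nat n * (of_nat n - (1 :: 'p mod_ring))" for n
    by (induction n) (auto simp: algebra_simps)
  from this[of "CARD('p)"] show ?thesis using two_neq_0[OF assms] by simp
qed

text \<open>Telescoping gives \<open>3 * eps = (p - 1) * p * (p + 1) = 0\<close>. So
  \<open>eps\<close> vanishes outside characteristic 3, and in characteristic 3 cubing is the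
  Frobenius map, which is trivial on the prime field.\<close>

lemma eps_eq_0_or_cube: "eps = (0 :: 'p::prime_card mod_ring) \<or> (\<forall>x :: 'p mod_ring. x ^ 3 = x)"
proof -
  have "3 * (\<Sum>i<n. of_nat i * (of_nat i + 1)) = (of_nat n - 1) * of_nat n * (of_nat n + (1 :: 'p mod_ring))" for n
    by (induction n) (auto simp: algebra_simps)
  from this[of "CARD('p)"] have "3 * (eps :: 'p mod_ring) = 0" by (simp add: eps_def)
  then consider "eps = (0 :: 'p mod_ring)" | "(3 :: 'p mod_ring) = 0" by auto
  then show ?thesis
  proof cases
    case 2
    have "x ^ 3 = x" for x :: "'p mod_ring"
    proof (induction x rule: nat_induct_mod_ring)
      case (2 x)
      have "(x + 1) ^ 3 = x ^ 3 + 1 + 3 * (x ^ 2 + x)"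
        by (simp add: power3_eq_cube power2_eq_square algebra_simps)
      with 2 \<open>3 = 0\<close> show ?case by simp
    qed simp
    then show ?thesis by blast
  qed simp
qed

lemma eps_cube: "eps * (x * (x * x)) = eps * (x :: 'p::prime_card mod_ring)"
  using eps_eq_0_or_cube[where 'p = 'p] by (auto simp: power3_eq_cube)

lemma eps_square: "x \<noteq> 0 \<Longrightarrow> eps * (x * x) = (eps :: 'p::prime_card mod_ring)"
  using eps_cube[of x] by (metis (no_types, lifting) mult.commute mult.left_commute mult_left_cancel)

text \<open>Squaring is two-to-one on the units, so the nonzero squares are half of them.
  Multiplication by a nonsquare maps this half injectively to a disjoint set of the same size, which
  must be the other half.\<close>

lemma square_classes:
  assumes "CARD('p) > 2"
  obtains \<nu> :: "'p::prime_card mod_ring" where "\<nu> \<noteq> 0" "\<And>a. \<nu> \<noteq> a * a"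
    "\<And>t. t \<noteq> 0 \<Longrightarrow> \<exists>a. a \<noteq> 0 \<and> (t = a * a \<or> t = \<nu> * (a * a))"
proof -
  let ?U = "UNIV - {0 :: 'p mod_ring}"
  let ?S = "(\<lambda>a. a * a) ` ?U"
  have fib: "card {a \<in> ?U. a * a = s} = 2" if s: "s \<in> ?S" for s
  proof -
    from s obtain b where b: "b \<noteq> 0" "s = b * b" by auto
    have "{a \<in> ?U. a * a = s} = {b, - b}"
      using b by (auto simp: square_eq_iff)
    moreover have "b \<noteq> - b"
    proof
      assume "b = - b"
      then have "2 * b = 0" by (metis add.right_inverse mult_2)
      then show False using b two_neq_0[OF assms] by simp
    qed
    ultimately show ?thesis by simp
  qed
  have "card ?U = (\<Sum>s\<in>?S. card {a \<in> ?U. a * a = s})"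
    using sum.image_gen[of ?U "\<lambda>_. 1 :: nat" "\<lambda>a. a * a"] by simp
  also have "\<dots> = 2 * card ?S" using fib by simp
  finally have cU: "card ?U = 2 * card ?S" .
  have "1 \<in> ?U" by simp
  then have "card ?U > 0" by (metis card_gt_0_iff empty_iff finite)
  then have "card ?S < card ?U" using cU by simp
  then have "\<not> ?U \<subseteq> ?S" using card_mono[of ?S ?U] by fastforce
  then obtain \<nu> where \<nu>: "\<nu> \<noteq> 0" "\<nu> \<notin> ?S" by auto
  have nsq: "\<nu> \<noteq> a * a" for a using \<nu> by (cases "a = 0") auto
  let ?T = "(*) \<nu> ` ?S"
  have disj: "?S \<inter> ?T = {}"
  proof (rule ccontr)
    assume "?S \<inter> ?T \<noteq> {}"
    then obtain a b where "a \<noteq> 0" "b \<noteq> 0" "a * a = \<nu> * (b * b)" by auto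
    then have "\<nu> = (a / b) * (a / b)" by (simp add: field_simps)
    then show False using nsq by blast
  qed
  have "card ?T = card ?S" by (rule card_image) (use \<nu> in \<open>auto simp: inj_on_def\<close>)
  then have "card (?S \<union> ?T) = card ?U" using cU disj by (simp add: card_Un_disjoint)
  moreover have "?S \<union> ?T \<subseteq> ?U" using \<nu> by auto
  ultimately have U: "?S \<union> ?T = ?U" by (intro card_subset_eq) auto
  have "\<exists>a. a \<noteq> 0 \<and> (t = a * a \<or> t = \<nu> * (a * a))" if "t \<noteq> 0" for t
  proof -
    have "t \<in> ?S \<union> ?T" using U that by auto
    then show ?thesis by auto
  qed
  with \<nu> nsq show thesis using that by blast
qed

section \<open>Finite loops and central shifts\<close>

definition epi :: "'a set \<Rightarrow> ('a \<Rightarrow> 'a \<Rightarrow> 'a) \<Rightarrow> 'b set \<Rightarrow> ('b \<Rightarrow> 'b \<Rightarrow> 'b) \<Rightarrow> ('a \<Rightarrow> 'b) \<Rightarrow> bool" where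
  "epi A m B m' q \<longleftrightarrow> q ` A = B \<and> (\<forall>x\<in>A. \<forall>y\<in>A. q (m x y) = m' (q x) (q y))"

definition cnb_loop :: "'a set \<Rightarrow> ('a \<Rightarrow> 'a \<Rightarrow> 'a) \<Rightarrow> bool" where
  "cnb_loop A m \<longleftrightarrow> is_loop A m \<and> right_bol A m \<and> centrally_nilpotent A m"

lemma surj_bij_betw: "finite B \<Longrightarrow> f ` B = B \<Longrightarrow> bij_betw f B B"
  by (simp add: bij_betw_def eq_card_imp_inj_on)

text \<open>Translations of the image are visibly surjective; their injectivity comes from
  finiteness. A homomorphic image of an infinite loop may fail to have cancellation.\<close>

lemma is_loop_epi:
  assumes q: "epi A m B m' q" and A: "is_loop A m" and fin: "finite A"
  shows "is_loop B m'"
proof -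
  have B: "B = q ` A" and hom: "\<And>x y. x \<in> A \<Longrightarrow> y \<in> A \<Longrightarrow> m' (q x) (q y) = q (m x y)"
    using q by (auto simp: epi_def)
  have cl: "\<And>x y. x \<in> A \<Longrightarrow> y \<in> A \<Longrightarrow> m x y \<in> A" using A by (auto simp: is_loop_def)
  obtain e where e: "e \<in> A" "\<And>x. x \<in> A \<Longrightarrow> m e x = x" "\<And>x. x \<in> A \<Longrightarrow> m x e = x"
    using A unfolding is_loop_def by blast
  have finB: "finite B" using B fin by simp
  have "bij_betw (\<lambda>x. m' (q a) x) B B \<and> bij_betw (\<lambda>x. m' x (q a)) B B" if a: "a \<in> A" for a
  proof (intro conjI surj_bij_betw finB)
    have "(\<lambda>x. m a x) ` A = A" "(\<lambda>x. m x a) ` A = A"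
      using A a by (auto simp: is_loop_def bij_betw_def)
    moreover have "(\<lambda>x. m' (q a) x) ` B = q ` (\<lambda>x. m a x) ` A"
      "(\<lambda>x. m' x (q a)) ` B = q ` (\<lambda>x. m x a) ` A"
      unfolding B image_image by (auto simp: hom a intro!: image_cong)
    ultimately show "(\<lambda>x. m' (q a) x) ` B = B" "(\<lambda>x. m' x (q a)) ` B = B"
      using B by auto
  qed
  moreover have "\<exists>e\<in>B. \<forall>x\<in>B. m' e x = x \<and> m' x e = x"
    unfolding B by (rule bexI[of _ "q e"]) (use e hom in auto)
  moreover have "\<forall>x\<in>B. \<forall>y\<in>B. m' x y \<in> B" unfolding B using hom cl by auto
  ultimately show ?thesis unfolding is_loop_def by (auto simp: B)
qed

lemma right_bol_epi:
  assumes q: "epi A m B m' q" and A: "is_loop A m" and b: "right_bol A m"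
  shows "right_bol B m'"
proof -
  have B: "B = q ` A" and hom: "\<And>x y. x \<in> A \<Longrightarrow> y \<in> A \<Longrightarrow> m' (q x) (q y) = q (m x y)"
    using q by (auto simp: epi_def)
  have cl: "\<And>x y. x \<in> A \<Longrightarrow> y \<in> A \<Longrightarrow> m x y \<in> A" using A by (auto simp: is_loop_def)
  show ?thesis using b unfolding right_bol_def B by (auto simp: hom cl)
qed

text \<open>The map carries each congruence of the central series of \<open>A\<close> into the
  corresponding one of \<open>B\<close>, because an element central modulo \<open>\<theta>\<close>
  has an image central modulo any \<open>\<theta>'\<close> that contains the image of
  \<open>\<theta>\<close>. So the series of \<open>B\<close> fills up no later than that of
  \<open>A\<close>.\<close>

lemma centrally_nilpotent_epi:
  assumes q: "epi A m B m' q" and A: "is_loop A m" and b: "centrally_nilpotent A m"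
  shows "centrally_nilpotent B m'"
proof -
  have B: "B = q ` A" and hom: "\<And>x y. x \<in> A \<Longrightarrow> y \<in> A \<Longrightarrow> m' (q x) (q y) = q (m x y)"
    using q by (auto simp: epi_def)
  have cl: "\<And>x y. x \<in> A \<Longrightarrow> y \<in> A \<Longrightarrow> m x y \<in> A" using A by (auto simp: is_loop_def)
  obtain k where k: "(next_cong A m ^^ k) (Id_on A) = A \<times> A"
    using b by (auto simp: centrally_nilpotent_def)
  have step: "\<forall>(x, y) \<in> next_cong A m \<theta>. (q x, q y) \<in> next_cong B m' \<theta>'"
    if t: "\<forall>(x, y) \<in> \<theta>. (q x, q y) \<in> \<theta>'" for \<theta> \<theta>'
  proof -
    have c: "central_mod B m' \<theta>' (q c)" if "central_mod A m \<theta> c" for c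
      using that t unfolding central_mod_def B by (auto simp: hom cl)
    show ?thesis
      unfolding next_cong_def
    proof clarify
      fix x y c assume *: "x \<in> A" "y \<in> A" "central_mod A m \<theta> c" "(x, m y c) \<in> \<theta>"
      then have "c \<in> A" by (simp add: central_mod_def)
      with * t have "(q x, m' (q y) (q c)) \<in> \<theta>'" by (auto simp: hom)
      with c * show "q x \<in> B \<and> q y \<in> B \<and> (\<exists>c. central_mod B m' \<theta>' c \<and> (q x, m' (q y) c) \<in> \<theta>')"
        by (auto simp: B)
    qed
  qed
  have mono: "\<forall>(x, y) \<in> (next_cong A m ^^ n) (Id_on A). (q x, q y) \<in> (next_cong B m' ^^ n) (Id_on B)" for n
  proof (induction n)
    case 0
    show ?case by (auto simp: B)
  next
    case (Suc n)
    from step[OF Suc] show ?case by simp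
  qed
  have "(next_cong B m' ^^ n) (Id_on B) \<subseteq> B \<times> B" for n
    by (cases n) (auto simp: next_cong_def)
  moreover have "B \<times> B \<subseteq> (next_cong B m' ^^ k) (Id_on B)"
    using mono[of k] unfolding k B by auto
  ultimately show ?thesis unfolding centrally_nilpotent_def by blast
qed

lemma cnb_loop_epi: "epi A m B m' q \<Longrightarrow> finite A \<Longrightarrow> cnb_loop A m \<Longrightarrow> cnb_loop B m'"
  unfolding cnb_loop_def using is_loop_epi right_bol_epi centrally_nilpotent_epi by metis

lemma loop_iso_imp_epi: "loop_iso A m B m' \<Longrightarrow> \<exists>q. epi A m B m' q"
  unfolding loop_iso_def epi_def bij_betw_def by blast

lemma loop_isoI:
  "bij_betw f A B \<Longrightarrow> (\<And>x y. x \<in> A \<Longrightarrow> y \<in> A \<Longrightarrow> f (m x y) = m' (f x) (f y)) \<Longrightarrow> loop_iso A m B m'"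
  unfolding loop_iso_def by blast

lemma loop_iso_refl: "loop_iso A m A m"
  by (rule loop_isoI[of id]) auto

lemma loop_iso_trans: "loop_iso A m B m' \<Longrightarrow> loop_iso B m' C m'' \<Longrightarrow> loop_iso A m C m''"
  unfolding loop_iso_def
proof clarify
  fix f g assume f: "bij_betw f A B" "\<forall>x\<in>A. \<forall>y\<in>A. f (m x y) = m' (f x) (f y)"
    and g: "bij_betw g B C" "\<forall>x\<in>B. \<forall>y\<in>B. g (m' x y) = m'' (g x) (g y)"
  then show "\<exists>f. bij_betw f A C \<and> (\<forall>x\<in>A. \<forall>y\<in>A. f (m x y) = m'' (f x) (f y))"
    by (intro exI[of _ "g \<circ> f"]) (auto intro: bij_betw_trans dest: bij_betwE)
qed

lemma loop_iso_sym:
  assumes "loop_iso A m B m'" and cl: "\<And>x y. x \<in> A \<Longrightarrow> y \<in> A \<Longrightarrow> m x y \<in> A"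
  shows "loop_iso B m' A m"
proof -
  obtain f where f: "bij_betw f A B" "\<forall>x\<in>A. \<forall>y\<in>A. f (m x y) = m' (f x) (f y)"
    using assms by (auto simp: loop_iso_def)
  let ?g = "the_inv_into A f"
  have inj: "inj_on f A" and B: "B = f ` A" using f by (auto simp: bij_betw_def)
  show ?thesis
  proof (rule loop_isoI)
    show "bij_betw ?g B A" by (rule bij_betw_the_inv_into[OF f(1)])
    fix x y assume "x \<in> B" "y \<in> B"
    then obtain a b where ab: "a \<in> A" "b \<in> A" "x = f a" "y = f b" using B by auto
    then have "m' x y = f (m a b)" using f by simp
    then show "?g (m' x y) = m (?g x) (?g y)"
      using ab cl by (simp add: the_inv_into_f_f[OF inj])
  qed
qed

section \<open>Finite loops and right powers\<close>

locale finite_loop =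
  fixes A :: "'a set" and m :: "'a \<Rightarrow> 'a \<Rightarrow> 'a" and e :: 'a
  assumes fin: "finite A"
    and closed [intro, simp]: "x \<in> A \<Longrightarrow> y \<in> A \<Longrightarrow> m x y \<in> A"
    and unit_in [intro, simp]: "e \<in> A"
    and left_unit [simp]: "x \<in> A \<Longrightarrow> m e x = x"
    and right_unit [simp]: "x \<in> A \<Longrightarrow> m x e = x"
    and bij_left: "a \<in> A \<Longrightarrow> bij_betw (\<lambda>x. m a x) A A"
    and bij_right: "a \<in> A \<Longrightarrow> bij_betw (\<lambda>x. m x a) A A"
begin

lemma left_cancel: "a \<in> A \<Longrightarrow> x \<in> A \<Longrightarrow> y \<in> A \<Longrightarrow> m a x = m a y \<Longrightarrow> x = y"
  using bij_left[of a] by (auto simp: bij_betw_def inj_on_def)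

definition pw :: "'a \<Rightarrow> nat \<Rightarrow> 'a" where
  "pw u n = ((\<lambda>x. m x u) ^^ n) e"

lemma pw_0 [simp]: "pw u 0 = e" and pw_Suc: "pw u (Suc n) = m (pw u n) u"
  by (simp_all add: pw_def)

lemma pw_in [simp]: "u \<in> A \<Longrightarrow> pw u n \<in> A"
  by (induction n) (auto simp: pw_Suc)

text \<open>Right power alternativity: \<open>R_{u^n} = R_u^n\<close>, since the Bol identity reads
  \<open>R_{(yz)y} = R_y R_z R_y\<close>.\<close>

lemma bol_right_power:
  assumes bol: "right_bol A m" and u: "u \<in> A" and x: "x \<in> A"
  shows "m x (pw u n) = ((\<lambda>x. m x u) ^^ n) x"
  using x
proof (induction n arbitrary: x rule: induct_nat_012)
  case 0
  then show ?case by simp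
next
  case 1
  then show ?case using u pw_Suc[of u 0] by simp
next
  case (ge2 n)
  have "m u (pw u n) = pw u (Suc n)"
  proof -
    have "m u (pw u n) = ((\<lambda>x. m x u) ^^ n) u" using ge2.IH(1) u by simp
    also have "\<dots> = ((\<lambda>x. m x u) ^^ n) (m e u)" using u by simp
    also have "\<dots> = pw u (Suc n)"
      using funpow_swap1[of "\<lambda>x. m x u" n e] by (simp add: pw_def)
    finally show ?thesis .
  qed
  then have "pw u (Suc (Suc n)) = m (m u (pw u n)) u" by (simp add: pw_Suc)
  then have "m x (pw u (Suc (Suc n))) = m (m (m x u) (pw u n)) u"
    using bol ge2.prems u unfolding right_bol_def by simp
  also have "\<dots> = ((\<lambda>x. m x u) ^^ Suc (Suc n)) x"
    using ge2.IH(1)[of "m x u"] ge2.prems u funpow_swap1[of "\<lambda>x. m x u" n x] by simp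
  finally show ?case .
qed

lemma bol_pw_add:
  assumes "right_bol A m" and "u \<in> A"
  shows "m (pw u i) (pw u j) = pw u (i + j)"
proof -
  have "m (pw u i) (pw u j) = ((\<lambda>x. m x u) ^^ j) (pw u i)"
    using bol_right_power[OF assms] assms(2) by simp
  also have "\<dots> = pw u (j + i)" by (simp add: pw_def funpow_add)
  finally show ?thesis by (simp add: add.commute)
qed

end

lemma is_loop_finite_loop: "is_loop A m \<Longrightarrow> finite A \<Longrightarrow> \<exists>e. finite_loop A m e"
  unfolding is_loop_def finite_loop_def by blast

text \<open>A central shift of order \<open>N\<close> is translation by a central element of order \<open>N\<close>.\<close>

locale central_shift = finite_loop +
  fixes r :: "'a \<Rightarrow> 'a" and N :: nat
  assumes N_pos: "N > 0"
    and shift_in [simp]: "x \<in> A \<Longrightarrow> r x \<in> A"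
    and shift_left: "x \<in> A \<Longrightarrow> y \<in> A \<Longrightarrow> m (r x) y = r (m x y)"
    and shift_right: "x \<in> A \<Longrightarrow> y \<in> A \<Longrightarrow> m x (r y) = r (m x y)"
    and shift_order: "x \<in> A \<Longrightarrow> (r ^^ N) x = x"
    and shift_free: "x \<in> A \<Longrightarrow> 0 < i \<Longrightarrow> i < N \<Longrightarrow> (r ^^ i) x \<noteq> x"
begin

lemma pow_in [simp]: "x \<in> A \<Longrightarrow> (r ^^ i) x \<in> A"
  by (induction i) auto

lemma pow_left: "x \<in> A \<Longrightarrow> y \<in> A \<Longrightarrow> m ((r ^^ i) x) y = (r ^^ i) (m x y)"
  by (induction i) (auto simp: shift_left)

lemma pow_right: "x \<in> A \<Longrightarrow> y \<in> A \<Longrightarrow> m x ((r ^^ i) y) = (r ^^ i) (m x y)"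
  by (induction i) (auto simp: shift_right)

lemma pow_mod: "x \<in> A \<Longrightarrow> (r ^^ (i mod N)) x = (r ^^ i) x"
  using funpow_mod_eq[where f = r] shift_order by blast

lemma pow_eq_iff:
  assumes x: "x \<in> A"
  shows "(r ^^ i) x = (r ^^ j) x \<longleftrightarrow> i mod N = j mod N"
proof
  have *: "i = j" if "(r ^^ i) x = (r ^^ j) x" "i \<le> j" "j < N" for i j
  proof (rule ccontr)
    assume "i \<noteq> j"
    have "(r ^^ (j - i)) ((r ^^ i) x) = (r ^^ i) x"
      using that by (metis comp_apply funpow_add le_add_diff_inverse2)
    moreover have "0 < j - i" "j - i < N" using that \<open>i \<noteq> j\<close> by auto
    ultimately show False using shift_free[of "(r ^^ i) x" "j - i"] x by simp
  qed
  assume "(r ^^ i) x = (r ^^ j) x"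
  then have "(r ^^ (i mod N)) x = (r ^^ (j mod N)) x" using pow_mod x by simp
  then show "i mod N = j mod N"
    using *[of "i mod N" "j mod N"] *[of "j mod N" "i mod N"] N_pos
    by (metis mod_less_divisor nle_le)
next
  assume "i mod N = j mod N"
  then show "(r ^^ i) x = (r ^^ j) x" using pow_mod[OF x] by metis
qed

definition orb :: "'a \<Rightarrow> 'a set" where
  "orb x = (\<lambda>i. (r ^^ i) x) ` {..<N}"

lemma in_orb_iff: "x \<in> A \<Longrightarrow> y \<in> orb x \<longleftrightarrow> (\<exists>i. y = (r ^^ i) x)"
  unfolding orb_def using pow_mod N_pos by (auto simp: image_iff) (metis lessThan_iff mod_less_divisor)

lemma orb_self: "x \<in> A \<Longrightarrow> x \<in> orb x"
  by (auto simp: in_orb_iff intro: exI[of _ 0])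

lemma orb_pow: "x \<in> A \<Longrightarrow> orb ((r ^^ i) x) = orb x"
proof -
  assume x: "x \<in> A"
  have "\<exists>j. (r ^^ k) x = (r ^^ j) ((r ^^ i) x)" for k
  proof -
    have "i \<le> N * i" using N_pos by simp
    then have "(r ^^ (k + (N * i - i))) ((r ^^ i) x) = (r ^^ (k + N * i)) x"
      by (metis comp_apply funpow_add add.assoc le_add_diff_inverse2)
    also have "\<dots> = (r ^^ k) x" using x by (simp add: pow_eq_iff)
    finally show ?thesis by metis
  qed
  moreover have "\<exists>j. (r ^^ k) ((r ^^ i) x) = (r ^^ j) x" for k
    by (metis comp_apply funpow_add)
  ultimately show ?thesis using x by (auto simp: in_orb_iff)
qed

lemma orb_eq_iff: "x \<in> A \<Longrightarrow> y \<in> A \<Longrightarrow> orb x = orb y \<longleftrightarrow> (\<exists>i. y = (r ^^ i) x)"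
  using orb_pow in_orb_iff orb_self by metis

lemma card_orb: "x \<in> A \<Longrightarrow> card (orb x) = N"
  unfolding orb_def by (subst card_image) (auto simp: inj_on_def pow_eq_iff)

lemma card_orbits: "card A = N * card (orb ` A)"
proof -
  have U: "\<Union> (orb ` A) = A" using orb_self by (auto simp: in_orb_iff)
  have "N * card (orb ` A) = card (\<Union> (orb ` A))"
  proof (rule card_partition)
    show "finite (orb ` A)" "finite (\<Union> (orb ` A))" using fin U by auto
    show "\<And>c. c \<in> orb ` A \<Longrightarrow> card c = N" using card_orb by auto
    fix c d assume cd: "c \<in> orb ` A" "d \<in> orb ` A" "c \<noteq> d"
    show "c \<inter> d = {}"
    proof (rule ccontr)
      assume "c \<inter> d \<noteq> {}"
      then obtain z x y where "x \<in> A" "y \<in> A" "c = orb x" "d = orb y" "z \<in> orb x" "z \<in> orb y"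
        using cd by auto
      then have "orb x = orb z" "orb y = orb z" using orb_pow by (auto simp: in_orb_iff)
      then show False using cd \<open>c = orb x\<close> \<open>d = orb y\<close> by simp
    qed
  qed
  then show ?thesis using U by simp
qed

text \<open>Representatives are picked arbitrarily; independence of the choice is contained in
  \<open>epi_orb\<close>.\<close>

definition orb_mult :: "'a set \<Rightarrow> 'a set \<Rightarrow> 'a set" where
  "orb_mult X Y = orb (m (SOME x. x \<in> A \<and> orb x = X) (SOME y. y \<in> A \<and> orb y = Y))"

lemma epi_orb: "epi A m (orb ` A) orb_mult orb"
  unfolding epi_def
proof (intro conjI ballI refl)
  fix x y assume xy: "x \<in> A" "y \<in> A"
  let ?s = "\<lambda>X. SOME x. x \<in> A \<and> orb x = X"
  have s: "?s (orb x) \<in> A \<and> orb (?s (orb x)) = orb x" if "x \<in> A" for x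
    by (rule someI[of "\<lambda>z. z \<in> A \<and> orb z = orb x" x]) (use that in simp)
  have ex: "\<exists>i. ?s (orb x) = (r ^^ i) x" if "x \<in> A" for x
    using orb_eq_iff[OF that conjunct1[OF s[OF that]]] s[OF that] by simp
  obtain i where i: "?s (orb x) = (r ^^ i) x" using ex[OF xy(1)] by (elim exE)
  obtain j where j: "?s (orb y) = (r ^^ j) y" using ex[OF xy(2)] by (elim exE)
  show "orb (m x y) = orb_mult (orb x) (orb y)"
    unfolding orb_mult_def i j using xy by (simp add: pow_left pow_right orb_pow)
qed

end

text \<open>If \<open>z\<close> is central of order \<open>N\<close> then \<open>N\<close> divides \<open>p^(k+1)\<close>, and a power of
  \<open>z\<close> has order \<open>p\<close>.\<close>

lemma exists_central_shift:
  assumes fl: "finite_loop A m e" and cn: "centrally_nilpotent A m"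
    and p: "prime p" and cardA: "card A = p ^ Suc k"
  shows "\<exists>r. central_shift A m e r p"
proof -
  interpret finite_loop A m e by (rule fl)
  \<comment> \<open>A trivial center would make \<open>Id_on A\<close> a fixed point of
    \<open>next_cong\<close>, and the central series would never leave it.\<close>
  have "\<exists>z. central_mod A m (Id_on A) z \<and> z \<noteq> e"
  proof (rule ccontr)
    assume "\<not> ?thesis"
    then have c: "central_mod A m (Id_on A) z \<Longrightarrow> z = e" for z by blast
    have "next_cong A m (Id_on A) \<subseteq> Id_on A"
      unfolding next_cong_def using c by (fastforce simp: Id_on_iff)
    moreover have "Id_on A \<subseteq> next_cong A m (Id_on A)"
      unfolding next_cong_def central_mod_def by (auto intro!: exI[of _ e])
    ultimately have 1: "next_cong A m (Id_on A) = Id_on A" by blast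
    have "(next_cong A m ^^ n) (Id_on A) = Id_on A" for n
      by (induction n) (auto simp: 1)
    then have "Id_on A = A \<times> A" using cn by (auto simp: centrally_nilpotent_def)
    then have "A \<subseteq> {e}" using unit_in by blast
    then have "card A \<le> 1" using card_mono[of "{e}" A] by simp
    then show False using cardA prime_gt_1_nat[OF p] by (metis Suc_neq_Zero linorder_not_le one_less_power zero_less_Suc)
  qed
  then obtain z where zc: "central_mod A m (Id_on A) z" and ze: "z \<noteq> e" by blast
  have z: "z \<in> A" using zc by (simp add: central_mod_def)
  define r where "r = (\<lambda>x. m x z)"
  have r_in: "r x \<in> A" if "x \<in> A" for x using that z by (simp add: r_def)
  have rp_in: "(r ^^ i) x \<in> A" if "x \<in> A" for x i using that by (induction i) (auto simp: r_in)
  have r_right: "m x (r y) = r (m x y)" if "x \<in> A" "y \<in> A" for x y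
    using that zc z unfolding central_mod_def r_def by (auto simp: Id_on_iff)
  have r_left: "m (r x) y = r (m x y)" if "x \<in> A" "y \<in> A" for x y
  proof -
    have "m x (m z y) = m (m x z) y" "m z y = m y z"
      using that zc unfolding central_mod_def Id_on_iff by metis+
    then show ?thesis using r_right[OF that] by (simp add: r_def)
  qed
  have rp_right: "m x ((r ^^ i) y) = (r ^^ i) (m x y)" if "x \<in> A" "y \<in> A" for x y i
    by (induction i) (use that rp_in r_right in auto)
  have rp_left: "m ((r ^^ i) x) y = (r ^^ i) (m x y)" if "x \<in> A" "y \<in> A" for x y i
    by (induction i) (use that rp_in r_left in auto)
  have inj: "inj_on r A" using bij_right[OF z] by (simp add: bij_betw_def r_def)
  \<comment> \<open>Since \<open>(r ^^ i) x\<close> is the product of \<open>x\<close> and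
    \<open>(r ^^ i) e\<close>, an iterate that fixes one point fixes all. This turns the order of
    \<open>z\<close> into freeness of the shift.\<close>
  have fix_iff: "(r ^^ i) x = x \<longleftrightarrow> (r ^^ i) e = e" if x: "x \<in> A" for x i
  proof -
    have "(r ^^ i) x = m x ((r ^^ i) e)" using rp_right[OF x unit_in] x by simp
    then show ?thesis using left_cancel[OF x rp_in[OF unit_in] unit_in, of i] x by auto
  qed
  have "\<exists>i>0. (r ^^ i) e = e"
  proof -
    have "\<not> inj (\<lambda>i. (r ^^ i) e)"
    proof
      assume "inj (\<lambda>i. (r ^^ i) e)"
      moreover have "range (\<lambda>i. (r ^^ i) e) \<subseteq> A" using rp_in by auto
      ultimately show False using fin by (meson finite_subset range_inj_infinite)
    qed
    then obtain i j where "(r ^^ i) e = (r ^^ j) e" "i \<noteq> j" by (auto simp: inj_def)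
    then obtain i j where "(r ^^ i) e = (r ^^ j) e" "i < j"
      by (cases i j rule: linorder_cases) (auto intro: sym)
    then have "(r ^^ (j - i)) ((r ^^ i) e) = (r ^^ i) e"
      by (metis comp_apply funpow_add le_add_diff_inverse2 less_imp_le)
    then show ?thesis using fix_iff[OF rp_in[OF unit_in]] \<open>i < j\<close> by (intro exI[of _ "j - i"]) auto
  qed
  define N where "N = (LEAST i. i > 0 \<and> (r ^^ i) e = e)"
  have N: "N > 0" "(r ^^ N) e = e"
    using LeastI_ex[OF \<open>\<exists>i>0. (r ^^ i) e = e\<close>] unfolding N_def by simp_all
  have least: "(r ^^ i) e \<noteq> e" if "0 < i" "i < N" for i
    using not_less_Least[of i "\<lambda>i. i > 0 \<and> (r ^^ i) e = e"] that unfolding N_def by simp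
  interpret z: central_shift A m e r N
  proof unfold_locales
    show "(r ^^ N) x = x" if "x \<in> A" for x using fix_iff[OF that, of N] N by simp
    show "(r ^^ i) x \<noteq> x" if "x \<in> A" "0 < i" "i < N" for x i
      using fix_iff[OF that(1), of i] least that by simp
  qed (simp_all add: N r_in r_left r_right)
  have "N dvd p ^ Suc k" using z.card_orbits cardA by (metis dvd_triv_left)
  then obtain j where j: "N = p ^ j" using divides_primepow_nat[OF p] by blast
  have "N \<noteq> 1"
  proof
    assume "N = 1"
    then have "r e = e" using N by simp
    then show False using ze z by (simp add: r_def)
  qed
  then obtain j' where j': "N = p * p ^ j'" using j by (cases j) auto
  let ?d = "p ^ j'"
  have rd: "((r ^^ ?d) ^^ i) x = (r ^^ (?d * i)) x" for i x
    by (simp add: funpow_mult mult.commute)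
  have dpos: "?d > 0" using p by (simp add: prime_gt_0_nat)
  have "central_shift A m e (r ^^ ?d) p"
  proof unfold_locales
    show "p > 0" using p by (simp add: prime_gt_0_nat)
    fix x i assume "x \<in> A" "0 < i" "i < p"
    then show "((r ^^ ?d) ^^ i) x \<noteq> x"
      using z.shift_free[of x "?d * i"] dpos j' unfolding rd by (simp add: mult.commute)
  next
    fix x assume "x \<in> A"
    then show "((r ^^ ?d) ^^ p) x = x"
      using z.shift_order[of x] j' unfolding rd by (simp add: mult.commute)
  qed (auto simp: rp_in rp_left rp_right)
  then show ?thesis by blast
qed

section \<open>Central extensions by a group of prime order\<close>

definition ext :: "('g::ab_group_add \<Rightarrow> 'g \<Rightarrow> 'f::ab_group_add) \<Rightarrow> 'g \<times> 'f \<Rightarrow> 'g \<times> 'f \<Rightarrow> 'g \<times> 'f" where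
  "ext \<theta> u v = (fst u + fst v, snd u + snd v + \<theta> (fst u) (fst v))"

definition normalized :: "('g::ab_group_add \<Rightarrow> 'g \<Rightarrow> 'f::ab_group_add) \<Rightarrow> bool" where
  "normalized \<theta> \<longleftrightarrow> (\<forall>x. \<theta> 0 x = 0 \<and> \<theta> x 0 = 0)"

definition cyc :: "nat \<Rightarrow> nat \<Rightarrow> nat \<Rightarrow> nat" where
  "cyc n i j = (i + j) mod n"

context central_shift
begin

lemma pow_commute: "(r ^^ i) ((r ^^ j) x) = (r ^^ j) ((r ^^ i) x)"
  by (metis add.commute comp_apply funpow_add)

lemma pow_rep_add:
  assumes "N = CARD('p::prime_card)" and "x \<in> A"
  shows "(r ^^ rep (a + b)) x = (r ^^ rep a) ((r ^^ rep (b :: 'p mod_ring)) x)"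
proof -
  have "(r ^^ rep (a + b)) x = (r ^^ (rep a + rep b)) x"
    using assms by (simp add: pow_eq_iff rep_add)
  then show ?thesis by (simp add: funpow_add)
qed

lemma quotient_map:
  assumes "loop_iso (orb ` A) orb_mult B m'"
  obtains q where "epi A m B m' q" "\<And>x y. x \<in> A \<Longrightarrow> y \<in> A \<Longrightarrow> q x = q y \<longleftrightarrow> (\<exists>i. y = (r ^^ i) x)"
proof -
  obtain f where f: "bij_betw f (orb ` A) B"
    and hom: "\<And>x y. x \<in> orb ` A \<Longrightarrow> y \<in> orb ` A \<Longrightarrow> f (orb_mult x y) = m' (f x) (f y)"
    using assms by (auto simp: loop_iso_def)
  have orb: "orb (m x y) = orb_mult (orb x) (orb y)" if "x \<in> A" "y \<in> A" for x y
    using epi_orb that by (simp add: epi_def)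
  show thesis
  proof (rule that[of "f \<circ> orb"])
    show "epi A m B m' (f \<circ> orb)"
      using f hom orb by (auto simp: epi_def bij_betw_def image_comp)
    fix x y assume "x \<in> A" "y \<in> A"
    then show "(f \<circ> orb) x = (f \<circ> orb) y \<longleftrightarrow> (\<exists>i. y = (r ^^ i) x)"
      using f by (auto simp: bij_betw_def orb_eq_iff[symmetric] dest: inj_onD)
  qed
qed

text \<open>A section \<open>s\<close> of \<open>q\<close> gives the coordinates
  \<open>(x, a)\<close> for the shift of \<open>s x\<close> by \<open>a\<close>, and
  \<open>\<theta>\<close> records by how much \<open>s\<close> fails to be multiplicative.\<close>

lemma extension_coordinates:
  fixes q :: "'a \<Rightarrow> 'g::ab_group_add"
  assumes N: "N = CARD('p::prime_card)" and q: "epi A m UNIV (+) q"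
    and fib: "\<And>x y. x \<in> A \<Longrightarrow> y \<in> A \<Longrightarrow> q x = q y \<longleftrightarrow> (\<exists>i. y = (r ^^ i) x)"
  shows "\<exists>\<theta> :: 'g \<Rightarrow> 'g \<Rightarrow> 'p mod_ring. normalized \<theta> \<and> loop_iso A m UNIV (ext \<theta>)"
proof -
  have hom: "q (m x y) = q x + q y" if "x \<in> A" "y \<in> A" for x y
    using q that by (simp add: epi_def)
  have qe: "q e = 0" using hom[of e e] by simp
  have q_pow: "q ((r ^^ i) x) = q x" if "x \<in> A" for x i
    using fib[of x "(r ^^ i) x"] that by auto
  have "\<forall>x. \<exists>y. y \<in> A \<and> q y = x" using q unfolding epi_def by (metis UNIV_I imageE)
  then obtain s0 where s0: "\<And>x. s0 x \<in> A \<and> q (s0 x) = x" by metis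
  \<comment> \<open>Passing the section through the unit over 0 is what makes
    \<open>\<theta>\<close> normalized.\<close>
  define s where "s = s0(0 := e)"
  have s: "s x \<in> A" "q (s x) = x" for x using s0 qe by (auto simp: s_def)
  have "\<forall>x y. \<exists>a :: 'p mod_ring. m (s x) (s y) = (r ^^ rep a) (s (x + y))"
  proof (intro allI)
    fix x y
    have "q (s (x + y)) = q (m (s x) (s y))" by (simp add: s hom)
    then obtain i where "m (s x) (s y) = (r ^^ i) (s (x + y))"
      using fib[of "s (x + y)" "m (s x) (s y)"] s(1) by auto
    then show "\<exists>a :: 'p mod_ring. m (s x) (s y) = (r ^^ rep a) (s (x + y))"
      using s N by (intro exI[of _ "of_nat i"]) (simp add: rep_of_nat pow_eq_iff)
  qed
  then obtain \<theta> :: "'g \<Rightarrow> 'g \<Rightarrow> 'p mod_ring"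
    where \<theta>: "\<And>x y. m (s x) (s y) = (r ^^ rep (\<theta> x y)) (s (x + y))" by metis
  have se: "s 0 = e" by (simp add: s_def)
  have zero: "a = 0" if "(r ^^ rep (a :: 'p mod_ring)) (s x) = s x" for a x
  proof -
    have "(r ^^ rep a) (s x) = (r ^^ 0) (s x)" using that by simp
    then have "rep a mod N = 0" using pow_eq_iff[OF s(1)] by (metis mod_0)
    then show ?thesis using rep_less[of a] N by (simp add: rep_eq_0_iff)
  qed
  have "normalized \<theta>"
    unfolding normalized_def
  proof (intro allI conjI)
    fix x
    show "\<theta> 0 x = 0" using \<theta>[of 0 x] s se zero[of _ x] by simp
    show "\<theta> x 0 = 0" using \<theta>[of x 0] s se zero[of _ x] by simp
  qed
  moreover have "loop_iso UNIV (ext \<theta>) A m"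
  proof (rule loop_isoI)
    let ?f = "\<lambda>u :: 'g \<times> 'p mod_ring. (r ^^ rep (snd u)) (s (fst u))"
    have "inj ?f"
    proof (rule injI)
      fix u v assume eq: "?f u = ?f v"
      then have "q (?f u) = q (?f v)" by simp
      then have 1: "fst u = fst v" by (simp add: q_pow s)
      then have "rep (snd u) mod N = rep (snd v) mod N" using eq s by (simp add: pow_eq_iff)
      then have "snd u = snd v" using rep_less N by (metis mod_less rep_inj)
      with 1 show "u = v" by (simp add: prod_eq_iff)
    qed
    moreover have "range ?f = A"
    proof (intro equalityI subsetI)
      fix y assume y: "y \<in> A"
      then have "\<exists>i. y = (r ^^ i) (s (q y))" using fib[of "s (q y)" y] s by simp
      then obtain i where i: "(r ^^ i) (s (q y)) = y" by metis
      have "?f (q y, of_nat i) = (r ^^ i) (s (q y))" using s N by (simp add: rep_of_nat pow_eq_iff)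
      then have "?f (q y, of_nat i) = y" using i by (rule trans)
      then show "y \<in> range ?f" by (rule range_eqI[OF sym])
    qed (use s in auto)
    ultimately show "bij_betw ?f UNIV A" by (simp add: bij_betw_def)
    fix u v
    show "?f (ext \<theta> u v) = m (?f u) (?f v)"
      using s pow_commute[of "rep (snd u)" "rep (snd v)"]
      by (simp add: ext_def pow_left pow_right \<theta> pow_rep_add[OF N])
  qed
  ultimately show ?thesis using loop_iso_sym by (metis UNIV_I)
qed

text \<open>Lift a generator of the quotient to \<open>u\<close>; then \<open>pw u n\<close> is the
  unit shifted by some \<open>t\<close>. If p divides \<open>t\<close>, the powers of
  \<open>u\<close> form a complement to the central subgroup. Otherwise \<open>pw u n\<close>
  generates that subgroup and every element is a power of \<open>u\<close>. Products of powers are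
  computed by \<open>bol_pw_add\<close>, so associativity is nowhere assumed.\<close>

lemma cyclic_extension:
  assumes N: "N = CARD('p::prime_card)" and bol: "right_bol A m" and n: "n > 0"
    and q: "epi A m {..<n} (cyc n) q" and cardA: "card A = N * n"
    and fib: "\<And>x y. x \<in> A \<Longrightarrow> y \<in> A \<Longrightarrow> q x = q y \<longleftrightarrow> (\<exists>i. y = (r ^^ i) x)"
  shows "loop_iso A m {..<N * n} (cyc (N * n)) \<or>
    loop_iso A m ({..<n} \<times> (UNIV :: 'p mod_ring set)) (\<lambda>u v. (cyc n (fst u) (fst v), snd u + snd v))"
proof -
  have hom: "q (m x y) = (q x + q y) mod n" if "x \<in> A" "y \<in> A" for x y
    using q that by (simp add: epi_def cyc_def)
  have q_less: "q x < n" if "x \<in> A" for x using q that by (auto simp: epi_def)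
  have "q e = (q e + q e) mod n" using hom[of e e] by simp
  then have qe: "q e = 0" using q_less[of e]
    by (cases "q e + q e < n") (auto simp: mod_if split: if_splits)
  \<comment> \<open>The form \<open>1 mod n\<close> includes the trivial quotient
    \<open>n = 1\<close>, from which order p is obtained.\<close>
  have "1 mod n \<in> q ` A" using q n by (simp add: epi_def)
  then obtain u where u: "u \<in> A" "q u = 1 mod n" by auto
  have q_pw: "q (pw u j) = j mod n" for j
    by (induction j) (simp_all add: qe pw_Suc u hom mod_simps)
  have gen: "\<exists>i j. j < n \<and> x = (r ^^ i) (pw u j)" if x: "x \<in> A" for x
  proof -
    have "q (pw u (q x)) = q x" using q_less[OF x] by (simp add: q_pw)
    then show ?thesis using fib[of "pw u (q x)" x] x u q_less[OF x] by auto
  qed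
  have "q e = q (pw u n)" by (simp add: q_pw qe)
  then obtain t where t: "pw u n = (r ^^ t) e" using fib[of e "pw u n"] u by auto
  have tk: "pw u (n * k) = (r ^^ (t * k)) e" for k
  proof (induction k)
    case (Suc k)
    have "pw u (n * Suc k) = m ((r ^^ t) e) ((r ^^ (t * k)) e)"
      using bol_pw_add[OF bol u(1), of n "n * k"] Suc t by simp
    also have "\<dots> = (r ^^ (t * Suc k)) e" by (simp add: pow_left pow_right funpow_add pow_commute[of t])
    finally show ?case .
  qed simp
  show ?thesis
  proof (cases "t mod N = 0")
    case True
    then have un: "pw u (n * k) = e" for k
      unfolding tk using pow_eq_iff[OF unit_in, of "t * k" 0] by (simp add: mod_eq_0_iff_dvd)
    have pmod: "pw u (j mod n) = pw u j" for j
      using bol_pw_add[OF bol u(1), of "n * (j div n)" "j mod n"] un u by simp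
    let ?f = "\<lambda>v :: nat \<times> 'p mod_ring. (r ^^ rep (snd v)) (pw u (fst v))"
    let ?P = "{..<n} \<times> (UNIV :: 'p mod_ring set)"
    have "?f ` ?P = A"
    proof (intro equalityI subsetI)
      fix x assume "x \<in> A"
      then obtain i j where ij: "j < n" "x = (r ^^ i) (pw u j)" using gen by blast
      moreover have "(r ^^ i) (pw u j) = ?f (j, of_nat i)"
        using u N by (simp add: rep_of_nat pow_eq_iff)
      ultimately show "x \<in> ?f ` ?P" by (intro image_eqI[of _ _ "(j, of_nat i)"]) auto
    qed (use u in auto)
    moreover have "card ?P = card A" using cardA N by (simp add: card_cartesian_product mult.commute)
    ultimately have "bij_betw ?f ?P A"
      by (simp add: bij_betw_def eq_card_imp_inj_on)
    then have "loop_iso ?P (\<lambda>u v. (cyc n (fst u) (fst v), snd u + snd v)) A m"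
    proof (rule loop_isoI)
      fix v w
      show "?f (cyc n (fst v) (fst w), snd v + snd w) = m (?f v) (?f w)"
        using u pow_commute[of "rep (snd v)" "rep (snd w)"]
        by (simp add: cyc_def pmod bol_pw_add[OF bol] pow_left pow_right pow_rep_add[OF N])
    qed
    from loop_iso_sym[OF this] show ?thesis using n by (simp add: cyc_def mem_Times_iff)
  next
    case False
    have t0: "(of_nat t :: 'p mod_ring) \<noteq> 0"
      using of_nat_eq_mod_iff[of t 0, where 'p = 'p] False N by simp
    have gen': "\<exists>k. x = pw u k" if "x \<in> A" for x
    proof -
      from gen[OF that] obtain i j where ij: "x = (r ^^ i) (pw u j)" by (elim exE conjE)
      \<comment> \<open>\<open>k\<close> solves \<open>t * k = i\<close> modulo p, so that
        \<open>pw u (n * k)\<close> is the unit shifted by \<open>i\<close>.\<close>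
      define k where "k = rep (of_nat i / of_nat t :: 'p mod_ring)"
      have "(of_nat (t * k) :: 'p mod_ring) = of_nat i"
        using t0 by (simp add: k_def)
      then have "(r ^^ (t * k)) e = (r ^^ i) e"
        using of_nat_eq_mod_iff[of "t * k" i, where 'p = 'p] N by (simp add: pow_eq_iff)
      then have "x = m (pw u (n * k)) (pw u j)"
        unfolding tk ij using pow_left[of e "pw u j" i] u by simp
      then show ?thesis using bol_pw_add[OF bol u(1)] by blast
    qed
    have un: "pw u (N * n * k) = e" for k
      using tk[of "N * k"] pow_eq_iff[OF unit_in, of "t * (N * k)" 0]
      by (simp add: mult.left_commute mult.commute mult.assoc)
    have pmod: "pw u (j mod (N * n)) = pw u j" for j
      using bol_pw_add[OF bol u(1), of "N * n * (j div (N * n))" "j mod (N * n)"] un u by simp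
    have "pw u ` {..<N * n} = A"
    proof (intro equalityI subsetI)
      fix x assume "x \<in> A"
      then obtain k where "x = pw u (k mod (N * n))" using gen' pmod by metis
      then show "x \<in> pw u ` {..<N * n}" using n N_pos by auto
    qed (use u in auto)
    then have "bij_betw (pw u) {..<N * n} A"
      using cardA by (simp add: bij_betw_def eq_card_imp_inj_on)
    then have "loop_iso {..<N * n} (cyc (N * n)) A m"
      by (rule loop_isoI) (use u in \<open>simp add: cyc_def pmod bol_pw_add[OF bol]\<close>)
    from loop_iso_sym[OF this] show ?thesis using n N_pos by (simp add: cyc_def)
  qed
qed

end

section \<open>Orders p, \<open>p^2\<close> and \<open>p^3\<close>\<close>

lemma cnb_central_shift:
  assumes "cnb_loop A m" and "card A = CARD('p::prime_card) ^ Suc k"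
  obtains e r where "central_shift A m e r CARD('p)"
    "cnb_loop (central_shift.orb r CARD('p) ` A) (central_shift.orb_mult A m r CARD('p))"
    "card (central_shift.orb r CARD('p) ` A) = CARD('p) ^ k"
proof -
  have fin: "finite A" using assms(2) by (intro card_ge_0_finite) simp
  obtain e where "finite_loop A m e"
    using assms(1) fin is_loop_finite_loop by (auto simp: cnb_loop_def)
  then obtain r where r: "central_shift A m e r CARD('p)"
    using exists_central_shift[of A m e "CARD('p)" k] assms prime_card[where 'a = 'p]
    by (auto simp: cnb_loop_def)
  interpret central_shift A m e r "CARD('p)" by (rule r)
  show thesis
  proof (rule that[OF r])
    show "cnb_loop (orb ` A) orb_mult" using cnb_loop_epi[OF epi_orb fin assms(1)] .
    show "card (orb ` A) = CARD('p) ^ k" using card_orbits assms(2) by simp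
  qed
qed

lemma loop_iso_cyc_mod_ring:
  "loop_iso {..<CARD('p)} (cyc CARD('p)) (UNIV :: 'p::prime_card mod_ring set) (+)"
proof (rule loop_isoI)
  show "bij_betw (of_nat :: nat \<Rightarrow> 'p mod_ring) {..<CARD('p)} UNIV"
    by (rule bij_betw_byWitness[where f' = rep]) (auto simp: rep_of_nat rep_less)
  fix x y
  show "of_nat (cyc CARD('p) x y) = of_nat x + (of_nat y :: 'p mod_ring)"
    unfolding of_nat_add[symmetric] of_nat_eq_mod_iff by (simp add: cyc_def)
qed

text \<open>A single orbit of the shift is the whole loop, so this is
  \<open>cyclic_extension\<close> over the trivial quotient; both of its outcomes are the group of
  order p.\<close>

lemma cnb_order_p:
  assumes A: "cnb_loop A m" and card: "card A = CARD('p::prime_card)"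
  shows "loop_iso A m {..<CARD('p)} (cyc CARD('p))"
proof -
  obtain e r where r: "central_shift A m e r CARD('p)"
    and "card (central_shift.orb r CARD('p) ` A) = CARD('p) ^ 0"
    using cnb_central_shift[of A m 0, where 'p = 'p] A card by simp metis
  interpret central_shift A m e r "CARD('p)" by (rule r)
  have "card (orb ` A) = 1" using card card_orbits by simp
  then obtain X where X: "orb ` A = {X}" by (metis card_1_singletonE)
  have "loop_iso A m {..<CARD('p) * 1} (cyc (CARD('p) * 1)) \<or>
    loop_iso A m ({..<1} \<times> (UNIV :: 'p mod_ring set)) (\<lambda>u v. (cyc 1 (fst u) (fst v), snd u + snd v))"
  proof (rule cyclic_extension)
    show "right_bol A m" using A by (simp add: cnb_loop_def)
    show "epi A m {..<1} (cyc 1) (\<lambda>_. 0)" by (auto simp: epi_def cyc_def)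
    fix x y assume xy: "x \<in> A" "y \<in> A"
    then have "orb x = orb y" using X by blast
    then show "(0 :: nat) = 0 \<longleftrightarrow> (\<exists>i. y = (r ^^ i) x)" using xy orb_eq_iff by simp
  qed (use card in auto)
  moreover have i1: "loop_iso ({..<1} \<times> (UNIV :: 'p mod_ring set)) (\<lambda>u v. (cyc 1 (fst u) (fst v), snd u + snd v))
      (UNIV :: 'p mod_ring set) (+)"
    by (rule loop_isoI[of snd]) (auto simp: bij_betw_def inj_on_def image_iff)
  moreover have i2: "loop_iso (UNIV :: 'p mod_ring set) (+) {..<CARD('p)} (cyc CARD('p))"
    by (rule loop_iso_sym[OF loop_iso_cyc_mod_ring]) (simp add: cyc_def)
  ultimately show ?thesis using loop_iso_trans[OF _ loop_iso_trans[OF i1 i2], of A m] by auto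
qed

lemma cnb_order_p2:
  assumes A: "cnb_loop A m" and card: "card A = CARD('p::prime_card) ^ 2"
  shows "loop_iso A m {..<CARD('p) * CARD('p)} (cyc (CARD('p) * CARD('p))) \<or>
    loop_iso A m (UNIV :: ('p mod_ring \<times> 'p mod_ring) set) (+)"
proof -
  obtain e r where r: "central_shift A m e r CARD('p)"
    and B: "cnb_loop (central_shift.orb r CARD('p) ` A) (central_shift.orb_mult A m r CARD('p))"
    "card (central_shift.orb r CARD('p) ` A) = CARD('p) ^ 1"
    using cnb_central_shift[of A m 1, where 'p = 'p] A card by (auto simp: numeral_2_eq_2)
  interpret central_shift A m e r "CARD('p)" by (rule r)
  have "loop_iso (orb ` A) orb_mult {..<CARD('p)} (cyc CARD('p))"
    using cnb_order_p B by simp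
  then obtain q where "epi A m {..<CARD('p)} (cyc CARD('p)) q"
    "\<And>x y. x \<in> A \<Longrightarrow> y \<in> A \<Longrightarrow> q x = q y \<longleftrightarrow> (\<exists>i. y = (r ^^ i) x)"
    using quotient_map by metis
  then have "loop_iso A m {..<CARD('p) * CARD('p)} (cyc (CARD('p) * CARD('p))) \<or>
    loop_iso A m ({..<CARD('p)} \<times> (UNIV :: 'p mod_ring set)) (\<lambda>u v. (cyc CARD('p) (fst u) (fst v), snd u + snd v))"
    using A card by (intro cyclic_extension) (auto simp: cnb_loop_def power2_eq_square)
  moreover have i1: "loop_iso ({..<CARD('p)} \<times> (UNIV :: 'p mod_ring set))
      (\<lambda>u v. (cyc CARD('p) (fst u) (fst v), snd u + snd v))
      (UNIV :: ('p mod_ring \<times> 'p mod_ring) set) (+)"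
  proof (rule loop_isoI[of "\<lambda>u. (of_nat (fst u), snd u)"])
    show "bij_betw (\<lambda>u. (of_nat (fst u) :: 'p mod_ring, snd u :: 'p mod_ring)) ({..<CARD('p)} \<times> UNIV) UNIV"
      by (rule bij_betw_byWitness[where f' = "\<lambda>u. (rep (fst u), snd u)"])
        (auto simp: rep_of_nat rep_less)
    fix u v :: "nat \<times> 'p mod_ring"
    have "(of_nat (cyc CARD('p) (fst u) (fst v)) :: 'p mod_ring) = of_nat (fst u) + of_nat (fst v)"
      unfolding of_nat_add[symmetric] of_nat_eq_mod_iff by (simp add: cyc_def)
    then show "(of_nat (fst (cyc CARD('p) (fst u) (fst v), snd u + snd v)) :: 'p mod_ring,
        snd (cyc CARD('p) (fst u) (fst v), snd u + snd v))
      = (of_nat (fst u), snd u) + (of_nat (fst v), snd v)"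
      by simp
  qed
  ultimately show ?thesis using loop_iso_trans[OF _ i1, of A m] by auto
qed

text \<open>\<open>Z/p^2 x Z/p\<close> also has the quotient \<open>F_p^2\<close>: the low base-p
  digit joins the second factor in the base, and the high digit becomes the central coordinate,
  which receives the carry. Only the cyclic group then stays outside the extension form.\<close>

lemma loop_iso_cyc2_carry:
  "loop_iso ({..<CARD('p) * CARD('p)} \<times> (UNIV :: 'p mod_ring set))
      (\<lambda>u v. (cyc (CARD('p) * CARD('p)) (fst u) (fst v), snd u + snd v))
      (UNIV :: (('p::prime_card mod_ring \<times> 'p mod_ring) \<times> 'p mod_ring) set)
      (ext (\<lambda>x y. carry (fst x) (fst y)))"
proof (rule loop_iso_sym[OF loop_isoI])
  let ?p = "CARD('p)"
  let ?f = "\<lambda>u :: ('p mod_ring \<times> 'p mod_ring) \<times> 'p mod_ring.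
    (rep (fst (fst u)) + ?p * rep (snd u), snd (fst u))"
  let ?g = "\<lambda>u :: nat \<times> 'p mod_ring. ((of_nat (fst u) :: 'p mod_ring, snd u), of_nat (fst u div ?p) :: 'p mod_ring)"
  have less: "rep x + ?p * rep y < ?p * ?p" for x y :: "'p mod_ring"
  proof -
    have "rep x + ?p * rep y < ?p * Suc (rep y)" using rep_less[of x] by simp
    also have "\<dots> \<le> ?p * ?p" using rep_less[of y] by (intro mult_le_mono2) simp
    finally show ?thesis .
  qed
  show "bij_betw ?f UNIV ({..<?p * ?p} \<times> UNIV)"
  proof (rule bij_betw_byWitness[where f' = ?g])
    show "\<forall>u\<in>UNIV. ?g (?f u) = u" by (auto simp: rep_less)
    show "\<forall>u\<in>{..<?p * ?p} \<times> UNIV. ?f (?g u) = u"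
      by (auto simp: rep_of_nat less_mult_imp_div_less)
    show "?f ` UNIV \<subseteq> {..<?p * ?p} \<times> UNIV" using less by auto
  qed auto
  fix u v :: "('p mod_ring \<times> 'p mod_ring) \<times> 'p mod_ring"
  obtain x x' a y y' b where uv: "u = ((x, x'), a)" "v = ((y, y'), b)" by (metis prod.collapse)
  let ?c = "(rep x + rep y) div ?p"
  have "rep (a + b + carry x y) = (rep a + rep b + ?c) mod ?p"
    by (simp add: rep_add carry_def rep_of_nat mod_simps)
  then obtain k where k: "rep a + rep b + ?c = rep (a + b + carry x y) + ?p * k"
    by (metis mod_mult_div_eq)
  have "(rep x + ?p * rep a) + (rep y + ?p * rep b) = rep (x + y) + ?p * (rep a + rep b + ?c)"
    using rep_add_carry[of x y] by (simp add: algebra_simps)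
  also have "\<dots> = (rep (x + y) + ?p * rep (a + b + carry x y)) + ?p * ?p * k"
    unfolding k by (simp add: algebra_simps)
  finally have "((rep x + ?p * rep a) + (rep y + ?p * rep b)) mod (?p * ?p)
      = rep (x + y) + ?p * rep (a + b + carry x y)"
    using less by (simp only: mod_mult_self2 mod_less)
  then show "?f (ext (\<lambda>x y. carry (fst x) (fst y)) u v)
      = (cyc (?p * ?p) (fst (?f u)) (fst (?f v)), snd (?f u) + snd (?f v))"
    by (simp add: uv ext_def cyc_def)
qed simp

lemma cnb_order_p3:
  assumes A: "cnb_loop A m" and card: "card A = CARD('p::prime_card) ^ 3"
  shows "loop_iso A m {..<CARD('p) ^ 3} (cyc (CARD('p) ^ 3)) \<or>
    (\<exists>\<theta> :: ('p mod_ring \<times> 'p mod_ring) \<Rightarrow> ('p mod_ring \<times> 'p mod_ring) \<Rightarrow> 'p mod_ring.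
      normalized \<theta> \<and> loop_iso A m UNIV (ext \<theta>))"
proof -
  obtain e r where r: "central_shift A m e r CARD('p)"
    and B: "cnb_loop (central_shift.orb r CARD('p) ` A) (central_shift.orb_mult A m r CARD('p))"
    "card (central_shift.orb r CARD('p) ` A) = CARD('p) ^ 2"
    using cnb_central_shift[of A m 2, where 'p = 'p] A card by (auto simp: numeral_3_eq_3)
  interpret central_shift A m e r "CARD('p)" by (rule r)
  let ?n = "CARD('p) * CARD('p)"
  have p3: "CARD('p) * ?n = CARD('p) ^ 3" by (simp add: power3_eq_cube)
  from cnb_order_p2[OF B] show ?thesis
  proof
    assume "loop_iso (orb ` A) orb_mult {..<?n} (cyc ?n)"
    then obtain q where "epi A m {..<?n} (cyc ?n) q"
      "\<And>x y. x \<in> A \<Longrightarrow> y \<in> A \<Longrightarrow> q x = q y \<longleftrightarrow> (\<exists>i. y = (r ^^ i) x)"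
      using quotient_map by metis
    then have "loop_iso A m {..<CARD('p) * ?n} (cyc (CARD('p) * ?n)) \<or>
      loop_iso A m ({..<?n} \<times> (UNIV :: 'p mod_ring set)) (\<lambda>u v. (cyc ?n (fst u) (fst v), snd u + snd v))"
      using A card by (intro cyclic_extension) (auto simp: cnb_loop_def p3)
    then show ?thesis
    proof
      assume "loop_iso A m ({..<?n} \<times> (UNIV :: 'p mod_ring set)) (\<lambda>u v. (cyc ?n (fst u) (fst v), snd u + snd v))"
      from loop_iso_trans[OF this loop_iso_cyc2_carry]
      show ?thesis by (intro disjI2 exI conjI) (auto simp: normalized_def)
    qed (simp add: p3)
  next
    assume "loop_iso (orb ` A) orb_mult (UNIV :: ('p mod_ring \<times> 'p mod_ring) set) (+)"
    then obtain q :: "'a \<Rightarrow> 'p mod_ring \<times> 'p mod_ring" where "epi A m UNIV (+) q"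
      "\<And>x y. x \<in> A \<Longrightarrow> y \<in> A \<Longrightarrow> q x = q y \<longleftrightarrow> (\<exists>i. y = (r ^^ i) x)"
      using quotient_map by metis
    then show ?thesis using extension_coordinates[where 'p = 'p] by blast
  qed
qed

section \<open>Bol cocycles on the plane\<close>

definition bol_cocycle :: "('g::ab_group_add \<Rightarrow> 'g \<Rightarrow> 'f::ab_group_add) \<Rightarrow> bool" where
  "bol_cocycle \<theta> \<longleftrightarrow> normalized \<theta> \<and>
    (\<forall>x y z. \<theta> x y + \<theta> (x + y) z + \<theta> (x + y + z) y = \<theta> y z + \<theta> (y + z) y + \<theta> x (y + z + y))"

lemma bol_cocycle_zero: "bol_cocycle \<theta> \<Longrightarrow> \<theta> 0 x = 0" "bol_cocycle \<theta> \<Longrightarrow> \<theta> x 0 = 0"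
  by (simp_all add: bol_cocycle_def normalized_def)

lemma bol_cocycleD:
  "bol_cocycle \<theta> \<Longrightarrow>
    \<theta> x y + \<theta> (x + y) z + \<theta> (x + y + z) y = \<theta> y z + \<theta> (y + z) y + \<theta> x (y + z + y)"
  unfolding bol_cocycle_def by blast

definition cob :: "('g::ab_group_add \<Rightarrow> 'f::ab_group_add) \<Rightarrow> 'g \<Rightarrow> 'g \<Rightarrow> 'f" where
  "cob h x y = h (x + y) - h x - h y"

definition cohom :: "('g::ab_group_add \<Rightarrow> 'g \<Rightarrow> 'f::ab_group_add) \<Rightarrow> ('g \<Rightarrow> 'g \<Rightarrow> 'f) \<Rightarrow> bool" where
  "cohom \<theta> \<theta>' \<longleftrightarrow> (\<exists>h. \<forall>x y. \<theta> x y = \<theta>' x y + cob h x y)"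

lemma cohom_imp_loop_iso:
  assumes "cohom \<theta> \<theta>'" shows "loop_iso UNIV (ext \<theta>) UNIV (ext \<theta>')"
proof -
  obtain h where h: "\<And>x y. \<theta> x y = \<theta>' x y + cob h x y" using assms by (auto simp: cohom_def)
  show ?thesis
  proof (rule loop_isoI[of "\<lambda>u. (fst u, snd u - h (fst u))"])
    show "bij (\<lambda>u. (fst u, snd u - h (fst u)))"
      by (rule bij_betw_byWitness[where f' = "\<lambda>u. (fst u, snd u + h (fst u))"]) auto
  qed (simp add: ext_def h cob_def algebra_simps)
qed

lemma is_loop_ext:
  assumes "normalized \<theta>" shows "is_loop UNIV (ext \<theta>)"
proof -
  have "bij (ext \<theta> u)" for u
    by (rule bij_betw_byWitness[where f' = "\<lambda>v. (fst v - fst u, snd v - snd u - \<theta> (fst u) (fst v - fst u))"])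
      (auto simp: ext_def)
  moreover have "bij (\<lambda>v. ext \<theta> v u)" for u
    by (rule bij_betw_byWitness[where f' = "\<lambda>v. (fst v - fst u, snd v - snd u - \<theta> (fst v - fst u) (fst u))"])
      (auto simp: ext_def)
  moreover have "ext \<theta> (0, 0) u = u \<and> ext \<theta> u (0, 0) = u" for u
    using assms by (cases u) (auto simp: ext_def normalized_def)
  ultimately show ?thesis by (auto simp: is_loop_def)
qed

lemma right_bol_ext_iff:
  "right_bol UNIV (ext \<theta>) \<longleftrightarrow>
    (\<forall>x y z. \<theta> x y + \<theta> (x + y) z + \<theta> (x + y + z) y = \<theta> y z + \<theta> (y + z) y + \<theta> x (y + z + y))"
  (is "?L \<longleftrightarrow> ?R")
proof
  assume L: ?L
  show ?R
  proof (intro allI)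
    fix x y z
    have "ext \<theta> (ext \<theta> (ext \<theta> (x, 0) (y, 0)) (z, 0)) (y, 0)
        = ext \<theta> (x, 0) (ext \<theta> (ext \<theta> (y, 0) (z, 0)) (y, 0))"
      using L by (simp add: right_bol_def)
    then show "\<theta> x y + \<theta> (x + y) z + \<theta> (x + y + z) y = \<theta> y z + \<theta> (y + z) y + \<theta> x (y + z + y)"
      by (simp add: ext_def algebra_simps)
  qed
next
  assume R: ?R
  show ?L
    unfolding right_bol_def
  proof (intro ballI)
    fix u v w
    show "ext \<theta> (ext \<theta> (ext \<theta> u v) w) v = ext \<theta> u (ext \<theta> (ext \<theta> v w) v)"
      using R[rule_format, of "fst u" "fst v" "fst w"] by (simp add: ext_def algebra_simps)
  qed
qed

lemma next_congI:
  "x \<in> A \<Longrightarrow> y \<in> A \<Longrightarrow> central_mod A m \<theta> c \<Longrightarrow> (x, m y c) \<in> \<theta> \<Longrightarrow> (x, y) \<in> next_cong A m \<theta>"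
  by (auto simp: next_cong_def)

text \<open>The fibre over 0 is central, and modulo it only an abelian group remains, so two steps
  of \<open>next_cong\<close> suffice.\<close>

lemma cnb_loop_ext:
  fixes \<theta> :: "'g::ab_group_add \<Rightarrow> 'g \<Rightarrow> 'f::ab_group_add"
  assumes "bol_cocycle \<theta>" shows "cnb_loop UNIV (ext \<theta>)"
proof -
  note n = bol_cocycle_zero[OF assms]
  let ?U = "UNIV :: ('g \<times> 'f) set"
  let ?T = "next_cong ?U (ext \<theta>) (Id_on ?U)"
  have c0: "central_mod ?U (ext \<theta>) (Id_on ?U) (0, a)" for a
    by (auto simp: central_mod_def ext_def n algebra_simps Id_on_iff)
  have T: "(u, v) \<in> ?T" if "fst u = fst v" for u v
  proof -
    have "(u, ext \<theta> v (0, snd u - snd v)) \<in> Id_on ?U"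
      using that by (simp add: ext_def n prod_eq_iff Id_on_iff)
    then show ?thesis by (rule next_congI[OF UNIV_I UNIV_I c0])
  qed
  have c1: "central_mod ?U (ext \<theta>) ?T u" for u
    unfolding central_mod_def by (auto intro!: T simp: ext_def algebra_simps)
  have "(u, v) \<in> next_cong ?U (ext \<theta>) ?T" for u v
  proof -
    have "(u, ext \<theta> v (fst u - fst v, 0)) \<in> ?T" by (rule T) (simp add: ext_def)
    then show ?thesis by (rule next_congI[OF UNIV_I UNIV_I c1])
  qed
  then have "next_cong ?U (ext \<theta>) ?T = UNIV \<times> UNIV" by auto
  then have "(next_cong ?U (ext \<theta>) ^^ 2) (Id_on ?U) = UNIV \<times> UNIV" by (simp add: numeral_2_eq_2)
  then show ?thesis
    using assms is_loop_ext unfolding cnb_loop_def centrally_nilpotent_def right_bol_ext_iff bol_cocycle_def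
    by blast
qed

lemma bol_cocycle_add: "bol_cocycle \<theta> \<Longrightarrow> bol_cocycle \<theta>' \<Longrightarrow> bol_cocycle (\<lambda>x y. \<theta> x y + \<theta>' x y)"
proof -
  assume a: "bol_cocycle \<theta>" "bol_cocycle \<theta>'"
  have "\<theta> x y + \<theta>' x y + (\<theta> (x + y) z + \<theta>' (x + y) z) + (\<theta> (x + y + z) y + \<theta>' (x + y + z) y)
    = (\<theta> x y + \<theta> (x + y) z + \<theta> (x + y + z) y) + (\<theta>' x y + \<theta>' (x + y) z + \<theta>' (x + y + z) y)" for x y z
    by (simp add: algebra_simps)
  also have "\<dots> x y z = (\<theta> y z + \<theta> (y + z) y + \<theta> x (y + z + y)) + (\<theta>' y z + \<theta>' (y + z) y + \<theta>' x (y + z + y))" for x y z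
    using a by (simp add: bol_cocycle_def)
  finally show ?thesis using a by (simp add: bol_cocycle_def normalized_def algebra_simps)
qed

lemma bol_cocycle_mult:
  fixes \<theta> :: "'g::ab_group_add \<Rightarrow> 'g \<Rightarrow> 'f::comm_ring"
  assumes "bol_cocycle \<theta>" shows "bol_cocycle (\<lambda>x y. c * \<theta> x y)"
  using assms by (simp add: bol_cocycle_def normalized_def flip: distrib_left)

lemma bol_cocycle_cob: "h 0 = 0 \<Longrightarrow> bol_cocycle (cob h)"
  by (simp add: bol_cocycle_def normalized_def cob_def algebra_simps)

lemma bol_cocycle_comp:
  assumes "bol_cocycle \<theta>" and "\<And>x y. M (x + y) = M x + M y"
  shows "bol_cocycle (\<lambda>x y. \<theta> (M x) (M y))"
proof -
  have "M 0 = 0" using assms(2)[of 0 0] by simp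
  then show ?thesis using assms by (simp add: bol_cocycle_def normalized_def)
qed

lemma bol_cocycle_carry: "bol_cocycle (carry :: 'p::prime_card mod_ring \<Rightarrow> _)"
proof -
  have "carry x y + carry (x + y) z + carry (x + y + z) y
      = carry y z + carry (y + z) y + carry x (y + z + y)" for x y z :: "'p mod_ring"
    using carry_cocycle[of x y z] carry_cocycle[of x "y + z" y] by (simp add: algebra_simps)
  then show ?thesis by (simp add: bol_cocycle_def normalized_def)
qed

section \<open>Straightening a cocycle along a line\<close>

definition smul :: "'p::prime_card mod_ring \<Rightarrow> 'p mod_ring \<times> 'p mod_ring \<Rightarrow> 'p mod_ring \<times> 'p mod_ring" where
  "smul c x = (c * fst x, c * snd x)"

lemma smul_simps [simp]:
  "smul 0 x = 0" "smul 1 x = x" "smul (c + d) x = smul c x + smul d x"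
  "fst (smul c x) = c * fst x" "snd (smul c x) = c * snd x"
  by (simp_all add: smul_def algebra_simps zero_prod_def)

text \<open>Right power alternativity in cocycle form: the left side accumulates over n right
  translations by a lift of \<open>y\<close>, the right side over one translation by its n-th power.
  For \<open>n = p\<close> the term \<open>\<theta> x (smul (of_nat n) y)\<close> vanishes, so the
  sum along a line in direction \<open>y\<close> is the same for all parallel lines.\<close>

lemma bol_cocycle_power:
  assumes "bol_cocycle \<theta>"
  shows "(\<Sum>i<n. \<theta> (x + smul (of_nat i) y) y) = \<theta> x (smul (of_nat n) y) + (\<Sum>i<n. \<theta> (smul (of_nat i) y) y)"
proof (induction n arbitrary: x rule: induct_nat_012)
  case 0
  show ?case using bol_cocycle_zero[OF assms] by simp
next
  case 1
  show ?case using bol_cocycle_zero[OF assms] by simp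
next
  case (ge2 n)
  let ?n = "smul (of_nat n) y"
  let ?S = "\<Sum>i<n. \<theta> (smul (of_nat i) y) y"
  have split: "(\<Sum>i<Suc (Suc n). \<theta> (x + smul (of_nat i) y) y)
      = \<theta> x y + (\<theta> (x + y) ?n + ?S) + \<theta> (x + y + ?n) y" for x
  proof -
    have "(\<Sum>i<Suc (Suc n). \<theta> (x + smul (of_nat i) y) y)
        = \<theta> x y + (\<Sum>i<Suc n. \<theta> (x + smul (of_nat (Suc i)) y) y)"
      by (subst sum.lessThan_Suc_shift) simp
    also have "(\<Sum>i<Suc n. \<theta> (x + smul (of_nat (Suc i)) y) y)
        = (\<Sum>i<n. \<theta> ((x + y) + smul (of_nat i) y) y) + \<theta> (x + y + ?n) y"
      by (simp add: add.assoc)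
    finally show ?thesis using ge2.IH(1)[of "x + y"] by (simp add: add.assoc)
  qed
  have nn: "smul (of_nat (Suc (Suc n))) y = y + ?n + y"
    by (simp add: smul_def prod_eq_iff algebra_simps)
  have "\<theta> x y + \<theta> (x + y) ?n + \<theta> (x + y + ?n) y = \<theta> y ?n + \<theta> (y + ?n) y + \<theta> x (y + ?n + y)"
    "\<theta> 0 y = 0"
    by (rule bol_cocycleD[OF assms], rule bol_cocycle_zero[OF assms])
  then show ?case
    using split[of x] split[of 0] unfolding nn by (simp add: algebra_simps del: sum.lessThan_Suc of_nat_Suc)
qed

text \<open>The section is rebuilt by walking along lines parallel to the first axis. Going once
  around such a line leaves a discrepancy \<open>c\<close>, which by
  \<open>bol_cocycle_power\<close> does not depend on the line; it is the coefficient of the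
  carry.\<close>

lemma bol_cocycle_straighten:
  fixes \<theta> :: "'p::prime_card mod_ring \<times> 'p mod_ring \<Rightarrow> 'p mod_ring \<times> 'p mod_ring \<Rightarrow> 'p mod_ring"
  assumes "bol_cocycle \<theta>"
  obtains c h where "h 0 = 0" "\<And>x t. \<theta> x (t, 0) = c * carry (fst x) t + cob h x (t, 0)"
proof -
  let ?p = "CARD('p)"
  note n = bol_cocycle_zero[OF assms]
  define f where "f x1 x2 = \<theta> (x1, x2) (1, 0)" for x1 x2
  \<comment> \<open>The partial sum from 0 to \<open>rep (fst x) - 1\<close>: its coboundary
    reproduces \<open>\<theta> x (1, 0)\<close> except at the wrap-around, where the whole sum
    \<open>c\<close> is missing and the carry is 1.\<close>
  define h where "h x = (\<Sum>i<rep (fst x). f (of_nat i) (snd x))"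
    for x :: "'p mod_ring \<times> 'p mod_ring"
  define c where "c = (\<Sum>i<?p. f (of_nat i) 0)"
  have h0: "h 0 = 0" by (simp add: h_def)
  have c: "(\<Sum>i<?p. f (of_nat i) x2) = c" for x2
    using bol_cocycle_power[OF assms, where x = "(0, x2)" and y = "(1, 0)" and n = ?p] n
    by (simp add: f_def c_def smul_def flip: zero_prod_def)
  define \<theta>' where "\<theta>' x y = \<theta> x y + ((- c) * carry (fst x) (fst y) + (- 1) * cob h x y)" for x y
  have bol: "bol_cocycle \<theta>'"
    unfolding \<theta>'_def
    by (intro bol_cocycle_add bol_cocycle_mult assms bol_cocycle_cob h0
        bol_cocycle_comp[OF bol_cocycle_carry, of fst]) simp
  have e1: "\<theta>' x (1, 0) = 0" for x
  proof -
    obtain x1 x2 where x: "x = (x1, x2)" by (cases x)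
    have h1: "h (1, 0) = 0" using n(1)[of "(1, 0)"] by (simp add: h_def f_def zero_prod_def)
    show ?thesis
    proof (cases "rep x1 + 1 < ?p")
      case True
      then have "rep (x1 + 1) = Suc (rep x1)" by (simp add: rep_add)
      then have "h (x1 + 1, x2) = h (x1, x2) + f x1 x2" by (simp add: h_def)
      moreover have "carry x1 1 = 0" using True by (simp add: carry_def)
      ultimately show ?thesis using h1 by (simp add: \<theta>'_def x cob_def f_def)
    next
      case False
      then have r: "Suc (rep x1) = ?p" using rep_less[of x1] by simp
      then have "rep (x1 + 1) = 0" by (simp add: rep_add)
      then have "h (x1 + 1, x2) = 0" by (simp add: h_def)
      moreover have "carry x1 1 = 1" using r by (simp add: carry_def)
      moreover have "c = h (x1, x2) + f x1 x2"
        using c[of x2] unfolding r[symmetric] by (simp add: h_def)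
      ultimately show ?thesis using h1 by (simp add: \<theta>'_def x cob_def f_def)
    qed
  qed
  \<comment> \<open>Vanishing at the unit step spreads to all of its multiples, again by power
    alternativity.\<close>
  have "\<theta>' x (t, 0) = 0" for x t
    using bol_cocycle_power[OF bol, where x = x and y = "(1, 0)" and n = "rep t"] e1
    by (simp add: smul_def[of t])
  then have "\<theta> x (t, 0) = c * carry (fst x) t + cob h x (t, 0)" for x t
    by (simp add: \<theta>'_def algebra_simps)
  with h0 show thesis by (rule that)
qed

text \<open>The shape \<open>2 * n + m\<close> comes from the product \<open>(yz)y\<close> in the
  Bol identity. Taking \<open>m = 0\<close> gives \<open>f (2 * n) = 2 * f n\<close>, and halving,
  possible for odd p, recovers additivity.\<close>

lemma two_add_imp_linear:
  fixes f :: "'p::prime_card mod_ring \<Rightarrow> 'p mod_ring"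
  assumes p: "CARD('p) > 2" and f: "\<And>n m. f (2 * n + m) = 2 * f n + f m"
  shows "f n = f 1 * n"
proof (rule additive_mod_ring)
  have two: "(2 :: 'p mod_ring) \<noteq> 0" using two_neq_0[OF p] .
  have "f 0 = 2 * f 0 + f 0" using f[of 0 0] by (simp only: mult_zero_right add_0_right)
  then have "2 * f 0 = 0" by (metis add_cancel_right_left)
  with two have f0: "f 0 = 0" by simp
  fix x y
  have "f x = 2 * f (x / 2)" using f[of "x / 2" 0] two f0 by simp
  then show "f (x + y) = f x + f y" using f[of "x / 2" y] two by simp
qed

lemma const_diff_imp_affine:
  fixes g :: "'p::prime_card mod_ring \<Rightarrow> 'p mod_ring"
  assumes "\<And>x. g (x + 1) = g x + c"
  shows "g x = g 0 + c * x"
  by (induction x rule: nat_induct_mod_ring) (auto simp: assms algebra_simps)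

text \<open>The \<open>A\<close> and \<open>B\<close> terms, exchanged by swapping coordinates, are
  the nonassociative part; \<open>g\<close> multiplies the Heisenberg cocycle; \<open>c\<close> and
  \<open>d\<close> are the p-th powers of lifts of the two basis vectors.\<close>

definition fam :: "'p::prime_card mod_ring \<times> 'p mod_ring \<times> 'p mod_ring \<times> 'p mod_ring \<times> 'p mod_ring \<Rightarrow>
    'p mod_ring \<times> 'p mod_ring \<Rightarrow> 'p mod_ring \<times> 'p mod_ring \<Rightarrow> 'p mod_ring" where
  "fam = (\<lambda>(A, B, g, c, d) x y.
     A * (snd y * fst x * (fst x + fst y)) + B * (fst y * snd x * (snd x + snd y)) +
     g * (fst x * snd y) + c * carry (fst x) (fst y) + d * carry (snd x) (snd y))"

lemma bol_cocycle_fam: "bol_cocycle (fam w)"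
proof -
  obtain A B g c d where w: "w = (A, B, g, c, d)" by (metis prod.collapse)
  have "bol_cocycle (\<lambda>x y. (\<lambda>x y. A * (snd y * fst x * (fst x + fst y)) +
      B * (fst y * snd x * (snd x + snd y)) + g * (fst x * snd y)) x y
      + c * carry (fst x) (fst y) + d * carry (snd x) (snd y :: 'a mod_ring))"
    by (intro bol_cocycle_add bol_cocycle_mult bol_cocycle_comp[OF bol_cocycle_carry])
      (simp_all add: bol_cocycle_def normalized_def algebra_simps)
  then show ?thesis by (simp add: fam_def w)
qed

text \<open>Everything reduces to the values \<open>F n x1 x2\<close> at second arguments
  \<open>(0, n)\<close>. Special choices of \<open>y\<close> and \<open>z\<close> in the Bol
  identity make \<open>F\<close> quadratic in \<open>x1\<close> and then pin down how its
  coefficients depend on \<open>x2\<close> and \<open>n\<close>. The values on the second axis stay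
  free and are a one-variable problem.\<close>

lemma bol_cocycle_quadratic:
  fixes \<theta> :: "'p::prime_card mod_ring \<times> 'p mod_ring \<Rightarrow> 'p mod_ring \<times> 'p mod_ring \<Rightarrow> 'p mod_ring"
  assumes p: "CARD('p) > 2" and "bol_cocycle \<theta>" and straight: "\<And>x t. \<theta> x (t, 0) = 0"
  obtains \<alpha> \<beta> \<gamma> where "\<And>x1 x2 t n. \<theta> (x1, x2) (2 * t, n) = \<theta> (0, x2) (0, n)
    + \<alpha> * n * (x1 * x1 + 2 * x1 * t) + \<beta> * n * x2 * (x1 + t) + (\<gamma> * n + \<beta> * n * n / 2) * x1"
proof -
  have two: "(2 :: 'p mod_ring) \<noteq> 0" using two_neq_0[OF p] .
  have bol: "\<theta> x y + \<theta> (x + y) z + \<theta> (x + y + z) y = \<theta> y z + \<theta> (y + z) y + \<theta> x (y + z + y)" for x y z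
    by (rule bol_cocycleD[OF assms(2)])
  have nrm: "\<theta> (0, 0) x = 0" "\<theta> x (0, 0) = 0" for x
    using bol_cocycle_zero[OF assms(2), of x] by (simp_all add: zero_prod_def)
  define F where "F n x1 x2 = \<theta> (x1, x2) (0, n)" for n x1 x2
  have F0: "F n 0 0 = 0" "F 0 x1 x2 = 0" for n x1 x2 by (simp_all add: F_def nrm)
  \<comment> \<open>With \<open>y = (t, 0)\<close> and \<open>z = (0, n)\<close> one has
    \<open>y + z + y = (2 * t, n)\<close>, and straightness kills the terms whose second argument is
    \<open>y\<close>. So \<open>F\<close> determines \<open>\<theta>\<close>.\<close>
  have th: "\<theta> (x1, x2) (2 * t, n) = F n (x1 + t) x2 - F n t 0" for x1 x2 t n
    using bol[of "(x1, x2)" "(t, 0)" "(0, n)"] straight by (simp add: F_def algebra_simps)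
  have th': "\<theta> (x1, x2) (t + t, n) = F n (x1 + t) x2 - F n t 0" for x1 x2 t n
    using th[of x1 x2 t n] by (simp only: mult_2)
  have neg: "F (- n) x1 (x2 + n) = F (- n) 0 n - F n x1 x2" for n x1 x2
    using bol[of "(x1, x2)" "(0, n)" "(0, - n)"] by (simp add: F_def nrm algebra_simps)
  \<comment> \<open>Here \<open>y = (0, n)\<close> and \<open>z = (2 * t, - n)\<close>. After
    \<open>neg\<close> turns \<open>- n\<close> back into \<open>n\<close>, only \<open>F n\<close>
    at \<open>x1\<close>, \<open>x1 + t\<close> and \<open>x1 + 2 * t\<close> survives on the left:
    its second difference in \<open>x1\<close> depends on neither \<open>x1\<close> nor
    \<open>x2\<close>.\<close>
  have second: "F n x1 x2 - 2 * F n (x1 + t) x2 + F n (x1 + 2 * t) x2 = F n (2 * t) 0 - 2 * F n t 0"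
    for n x1 x2 t
  proof -
    have eq: "F n x1 x2 + (F (- n) (x1 + t) (x2 + n) - F (- n) t 0) + F n (x1 + 2 * t) x2
      = (F (- n) t n - F (- n) t 0) + F n (2 * t) 0 + (F n (x1 + t) x2 - F n t 0)"
      using bol[of "(x1, x2)" "(0, n)" "(2 * t, - n)"] th[of x1 "x2 + n" t "- n"]
        th[of 0 n t "- n"] th[of x1 x2 t n]
      by (simp add: F_def)
    have neg0: "F (- n) t n = F (- n) 0 n - F n t 0" using neg[of n t 0] by simp
    have "u + ((c - m) - r) + v = ((c - s) - r) + k + (m - s) \<Longrightarrow> u - 2 * m + v = k - 2 * s"
      for u c m r v s k :: "'p mod_ring"
    proof -
      assume "u + ((c - m) - r) + v = ((c - s) - r) + k + (m - s)"
      then show ?thesis by (rule iffD2[OF diff_eq_diff_eq, rotated]) (simp add: algebra_simps)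
    qed
    from this[OF eq[unfolded neg0 neg[of n "x1 + t" x2]]] show ?thesis .
  qed
  define a where "a n = (F n 2 0 - 2 * F n 1 0) / 2" for n
  define b where "b n x2 = F n 1 x2 - F n 0 x2 - a n" for n x2
  have quad: "F n x1 x2 = F n 0 x2 + b n x2 * x1 + a n * x1 * x1" for n x1 x2
  proof -
    have a2: "2 * a n = F n 2 0 - 2 * F n 1 0" using two by (simp add: a_def)
    let ?D = "\<lambda>x1. F n (x1 + 1) x2 - F n x1 x2"
    have s: "F n x x2 - 2 * F n (x + 1) x2 + F n (x + 1 + 1) x2 = 2 * a n" for x
      using second[of n x x2 1] a2 by (simp add: add.assoc)
    have "?D (x + 1) = ?D x + 2 * a n" for x
      by (rule iffD2[OF diff_eq_diff_eq s]) (simp add: algebra_simps)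
    then have Dx: "?D x = ?D 0 + 2 * a n * x" for x
      by (rule const_diff_imp_affine)
    have D: "F n (x + 1) x2 = F n x x2 + (b n x2 + a n) + 2 * a n * x" for x
      using Dx[of x] by (simp add: b_def algebra_simps)
    show ?thesis
    proof (induction x1 rule: nat_induct_mod_ring)
      case (2 x)
      then show ?case unfolding D by (simp add: algebra_simps)
    qed simp
  qed
  have dbl: "F (2 * n) x1 x2 = F n x1 x2 + F n x1 (x2 + n) - F n 0 n" for n x1 x2
    using bol[of "(x1, x2)" "(0, n)" "(0, 0)"] by (simp add: F_def nrm algebra_simps)
  \<comment> \<open>With \<open>y = (0, n)\<close> and \<open>z = (2, 0)\<close>, moving
    \<open>x2\<close> by \<open>n\<close> changes \<open>b n\<close> by a fixed amount; for
    \<open>n \<noteq> 0\<close> this makes \<open>b n\<close> affine in \<open>x2\<close>.\<close>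
  have b_step: "b n (x2 + n) = b n x2 + (b n n - b n 0)" for n x2
  proof -
    have "F n 0 x2 + F n 2 (x2 + n) = F n 2 n + (F (2 * n) 1 x2 - F (2 * n) 1 0)"
      using bol[of "(0, x2)" "(0, n)" "(2, 0)"] th[of 0 x2 1 "2 * n"] straight
      by (simp add: F_def algebra_simps)
    then show ?thesis
      unfolding dbl using quad[of n 2 "x2 + n"] quad[of n 2 n] quad[of n 1 x2] quad[of n 1 "x2 + n"]
        quad[of n 1 0] quad[of n 1 n] F0 by (simp add: algebra_simps)
  qed
  \<comment> \<open>At \<open>n = 0\<close> the quotient is 0 by convention, which is the right
    value because \<open>b 0\<close> vanishes identically.\<close>
  define \<beta>' where "\<beta>' n = (b n n - b n 0) / n" for n
  have a0: "a 0 = 0" by (simp add: a_def F0)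
  have b_affine: "b n x2 = b n 0 + \<beta>' n * x2" for n x2
  proof (cases "n = 0")
    case True
    then show ?thesis by (simp add: b_def F0 a0 \<beta>'_def)
  next
    case False
    have "b n (n * u) = b n (n * 0) + (b n n - b n 0) * u" for u
      by (rule const_diff_imp_affine[where g = "\<lambda>u. b n (n * u)"]) (simp add: distrib_left b_step)
    from this[of "x2 / n"] False show ?thesis by (simp add: \<beta>'_def field_simps)
  qed
  let ?c = "\<lambda>n. b n 0"
  have F: "F n x1 x2 = F n 0 x2 + (?c n + \<beta>' n * x2) * x1 + a n * x1 * x1" for n x1 x2
    using quad[of n x1 x2] b_affine[of n x2] by simp
  have mix: "F n x1 x2 + F m x1 (x2 + n) + F n x1 (x2 + n + m) = F m 0 n + F n 0 (n + m) + F (2 * n + m) x1 x2"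
    for n m x1 x2
    using bol[of "(x1, x2)" "(0, n)" "(0, m)"] by (simp add: F_def algebra_simps)
  let ?lin = "\<lambda>n m x2. (?c n + \<beta>' n * x2) + (?c m + \<beta>' m * (x2 + n)) + (?c n + \<beta>' n * (x2 + n + m))
    - (?c (2 * n + m) + \<beta>' (2 * n + m) * x2)"
  have coeff: "2 * a n + a m - a (2 * n + m) = 0" "?lin n m x2 = 0" for n m x2
  proof -
    have q: "?lin n m x2 * x1 + (2 * a n + a m - a (2 * n + m)) * x1 * x1 = 0" for x1
    proof -
      have "F n x1 x2 + F m x1 (x2 + n) + F n x1 (x2 + n + m)
          - (F n 0 x2 + F m 0 (x2 + n) + F n 0 (x2 + n + m))
        = F (2 * n + m) x1 x2 - F (2 * n + m) 0 x2"
        unfolding mix by simp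
      note eq = this[unfolded F[of n x1 x2] F[of m x1 "x2 + n"] F[of n x1 "x2 + n + m"] F[of "2 * n + m" x1 x2]]
      show ?thesis
        by (rule iffD2[OF diff_eq_diff_eq eq]) (simp add: algebra_simps)
    qed
    \<comment> \<open>A quadratic without constant term that vanishes at 1 and -1 has zero
      coefficients for odd p.\<close>
    have "2 * v = 0" if "u * 1 + v * 1 * 1 = 0" "u * - 1 + v * - 1 * - 1 = 0" for u v :: "'p mod_ring"
    proof -
      have "2 * v = (u * 1 + v * 1 * 1) + (u * - 1 + v * - 1 * - 1)" by simp
      then show ?thesis unfolding that by simp
    qed
    from this[OF q[of 1] q[of "-1"]] have "2 * (2 * a n + a m - a (2 * n + m)) = 0" .
    then show z: "2 * a n + a m - a (2 * n + m) = 0" using two by (simp only: mult_eq_0_iff simp_thms)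
    show "?lin n m x2 = 0" using q[of 1] unfolding z by simp
  qed
  have a_lin: "a n = a 1 * n" for n
    by (rule two_add_imp_linear[OF p]) (use coeff(1) in \<open>simp add: algebra_simps\<close>)
  have \<beta>_add: "\<beta>' (2 * n + m) = 2 * \<beta>' n + \<beta>' m" for n m
  proof -
    have "\<beta>' (2 * n + m) - (2 * \<beta>' n + \<beta>' m) = ?lin n m 0 - ?lin n m 1" by (simp add: algebra_simps)
    then show ?thesis by (simp only: coeff(2) diff_self right_minus_eq)
  qed
  then have \<beta>_lin: "\<beta>' n = \<beta>' 1 * n" for n by (rule two_add_imp_linear[OF p])
  have c_add: "?c (2 * n + m) = 2 * ?c n + ?c m + \<beta>' m * n + \<beta>' n * (n + m)" for n m
    using coeff(2)[where n = n and m = m and ?x2.0 = 0] by (simp add: algebra_simps)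
  define \<delta> where "\<delta> = \<beta>' 1 / 2"
  have \<beta>_eq: "\<beta>' n = 2 * \<delta> * n" for n using \<beta>_lin[of n] two by (simp add: \<delta>_def)
  \<comment> \<open>The extra terms in \<open>c_add\<close> are exactly the defect that
    \<open>\<delta> * n * n\<close> has in the same identity, so subtracting it leaves a linear
    function.\<close>
  define \<gamma>' where "\<gamma>' n = ?c n - \<delta> * n * n" for n
  have "\<gamma>' n = \<gamma>' 1 * n" for n
  proof (rule two_add_imp_linear[OF p])
    fix n m
    show "\<gamma>' (2 * n + m) = 2 * \<gamma>' n + \<gamma>' m"
      unfolding \<gamma>'_def c_add \<beta>_eq by (simp add: algebra_simps)
  qed
  then have c_lin: "?c n = \<gamma>' 1 * n + \<beta>' 1 * n * n / 2" for n
    by (simp add: \<gamma>'_def \<delta>_def algebra_simps)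
  have Fform: "F n x1 x2 = F n 0 x2 + (\<gamma>' 1 * n + \<beta>' 1 * n * n / 2 + \<beta>' 1 * n * x2) * x1 + a 1 * n * x1 * x1"
    for n x1 x2
    using F[of n x1 x2] a_lin[of n] \<beta>_lin[of n] c_lin[of n] by simp
  show thesis
  proof (rule that)
    fix x1 x2 t n
    show "\<theta> (x1, x2) (2 * t, n) = \<theta> (0, x2) (0, n) + a 1 * n * (x1 * x1 + 2 * x1 * t)
      + \<beta>' 1 * n * x2 * (x1 + t) + (\<gamma>' 1 * n + \<beta>' 1 * n * n / 2) * x1"
      unfolding th using Fform[of n "x1 + t" x2] Fform[of n t 0] F0
      by (simp add: F_def[symmetric] algebra_simps)
  qed
qed

text \<open>Straightening is used twice: along the first axis, so that
  \<open>bol_cocycle_quadratic\<close> applies, and then on the one-variable cocycle which that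
  lemma leaves free.\<close>

lemma cohom_fam:
  fixes \<theta> :: "'p::prime_card mod_ring \<times> 'p mod_ring \<Rightarrow> 'p mod_ring \<times> 'p mod_ring \<Rightarrow> 'p mod_ring"
  assumes p: "CARD('p) > 2" and bol: "bol_cocycle \<theta>"
  shows "\<exists>w. cohom \<theta> (fam w)"
proof -
  have two: "(2 :: 'p mod_ring) \<noteq> 0" using two_neq_0[OF p] .
  obtain c h where h0: "h 0 = 0" and h: "\<And>x t. \<theta> x (t, 0) = c * carry (fst x) t + cob h x (t, 0)"
    by (rule bol_cocycle_straighten[OF bol]) (rule that)
  define \<theta>1 where "\<theta>1 x y = \<theta> x y + ((- c) * carry (fst x) (fst y) + (- 1) * cob h x y)" for x y
  have bol1: "bol_cocycle \<theta>1"
    unfolding \<theta>1_def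
    by (intro bol_cocycle_add bol_cocycle_mult bol bol_cocycle_cob h0
        bol_cocycle_comp[OF bol_cocycle_carry, of fst]) simp
  have straight: "\<theta>1 x (t, 0) = 0" for x t by (simp add: \<theta>1_def h)
  obtain \<alpha> \<beta> \<gamma> where quad: "\<And>x1 x2 t n. \<theta>1 (x1, x2) (2 * t, n) = \<theta>1 (0, x2) (0, n)
    + \<alpha> * n * (x1 * x1 + 2 * x1 * t) + \<beta> * n * x2 * (x1 + t) + (\<gamma> * n + \<beta> * n * n / 2) * x1"
    by (rule bol_cocycle_quadratic[OF p bol1 straight]) (rule that)
  \<comment> \<open>The restriction to the second axis is reread as a cocycle in the first
    coordinate, so that \<open>bol_cocycle_straighten\<close> can be reused.\<close>
  define \<theta>2 where "\<theta>2 x y = \<theta>1 (0, fst x) (0, fst y)" for x y :: "'p mod_ring \<times> 'p mod_ring"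
  have bol2: "bol_cocycle \<theta>2"
    unfolding \<theta>2_def by (rule bol_cocycle_comp[OF bol1]) simp
  obtain d k where k: "k 0 = 0"
    "\<And>x t. \<theta>2 x (t, 0) = d * carry (fst x) t + cob k x (t, 0)"
    by (rule bol_cocycle_straighten[OF bol2]) (rule that)
  have psi: "\<theta>1 (0, x2) (0, n) = d * carry x2 n + (k (x2 + n, 0) - k (x2, 0) - k (n, 0))" for x2 n
    using k(2)[of "(x2, 0)" n] by (simp add: \<theta>2_def cob_def)
  let ?w = "(\<alpha>, - \<beta> / 2, \<gamma>, c, d)"
  \<comment> \<open>The coboundary of \<open>\<beta> / 2 * x1 * x2^2\<close> converts the
    \<open>\<beta>\<close> terms into the \<open>B\<close> term of \<open>fam\<close> with
    \<open>B = - \<beta> / 2\<close>.\<close>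
  let ?h = "\<lambda>x. h x + k (snd x, 0) + \<beta> / 2 * (fst x * snd x * snd x)"
  have "\<theta> x y = fam ?w x y + cob ?h x y" for x y
  proof -
    obtain x1 x2 y1 n where xy: "x = (x1, x2)" "y = (y1, n)" by (metis prod.collapse)
    define t where "t = y1 / 2"
    have y1: "y1 = 2 * t" using two by (simp add: t_def)
    define \<delta> where "\<delta> = \<beta> / 2"
    have \<beta>: "\<beta> = 2 * \<delta>" using two by (simp add: \<delta>_def)
    have "\<theta> x y = \<theta>1 (x1, x2) (2 * t, n) + c * carry x1 (2 * t) + cob h x y"
      by (simp add: \<theta>1_def xy y1)
    also have "\<theta>1 (x1, x2) (2 * t, n) = d * carry x2 n + (k (x2 + n, 0) - k (x2, 0) - k (n, 0))
      + \<alpha> * n * (x1 * x1 + 2 * x1 * t) + 2 * \<delta> * n * x2 * (x1 + t) + (\<gamma> * n + \<delta> * n * n) * x1"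
      unfolding quad psi using two by (simp add: \<beta>)
    finally show ?thesis
      using two unfolding \<beta> by (simp add: fam_def cob_def xy y1 algebra_simps)
  qed
  then show ?thesis unfolding cohom_def by blast
qed

section \<open>Commutator and power invariants\<close>

definition comm :: "('g \<Rightarrow> 'g \<Rightarrow> 'f::ab_group_add) \<Rightarrow> 'g \<Rightarrow> 'g \<Rightarrow> 'f" where
  "comm \<theta> x y = \<theta> x y - \<theta> y x"

text \<open>The fibre coordinate of the p-th power of any lift of \<open>x\<close>.\<close>

definition ppow :: "('p::prime_card mod_ring \<times> 'p mod_ring \<Rightarrow> 'p mod_ring \<times> 'p mod_ring \<Rightarrow> 'p mod_ring) \<Rightarrow>
    'p mod_ring \<times> 'p mod_ring \<Rightarrow> 'p mod_ring" where
  "ppow \<theta> x = (\<Sum>i<CARD('p). \<theta> (smul (of_nat i) x) x)"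

lemma comm_cob: "comm (\<lambda>x y. \<theta> x y + cob h x y) = comm \<theta>"
  by (simp add: comm_def cob_def fun_eq_iff algebra_simps)

lemma ppow_cob: "ppow (\<lambda>x y. \<theta> x y + cob h x y) x = ppow \<theta> x"
proof -
  have "(\<Sum>i<n. cob h (smul (of_nat i) x) x) = h (smul (of_nat n) x) - h 0 - of_nat n * h x" for n
    by (induction n) (simp_all add: cob_def algebra_simps)
  from this[of "CARD('a)"] show ?thesis by (simp add: ppow_def sum.distrib)
qed

lemma cohom_comm: "cohom \<theta> \<theta>' \<Longrightarrow> comm \<theta> x y = comm \<theta>' x y"
proof -
  assume "cohom \<theta> \<theta>'"
  then obtain h where "\<And>x y. \<theta> x y = \<theta>' x y + cob h x y" by (auto simp: cohom_def)
  then have "\<theta> = (\<lambda>x y. \<theta>' x y + cob h x y)" by (simp add: fun_eq_iff)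
  then show ?thesis by (simp add: comm_cob)
qed

lemma cohom_ppow: "cohom \<theta> \<theta>' \<Longrightarrow> ppow \<theta> x = ppow \<theta>' x"
proof -
  assume "cohom \<theta> \<theta>'"
  then obtain h where "\<And>x y. \<theta> x y = \<theta>' x y + cob h x y" by (auto simp: cohom_def)
  then have "\<theta> = (\<lambda>x y. \<theta>' x y + cob h x y)" by (simp add: fun_eq_iff)
  then show ?thesis by (simp add: ppow_cob)
qed

lemma comm_fam:
  "comm (fam (A, B, g, c, d)) (x1, x2) (y1, y2) = (x1 * y2 - x2 * y1) * (A * (x1 + y1) - B * (x2 + y2) + g)"
  by (simp add: comm_def fam_def carry_commute[of y1 x1] carry_commute[of y2 x2] algebra_simps)

text \<open>On multiples of one vector the terms separate: the cubic ones contribute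
  \<open>eps\<close>, the bilinear one a multiple of the sum of all residues, which is 0, and the
  carries the identity map.\<close>

lemma ppow_fam:
  fixes A :: "'p::prime_card mod_ring"
  assumes p: "CARD('p) > 2"
  shows "ppow (fam (A, B, g, c, d)) (x1, x2) = c * x1 + d * x2 + eps * (A * (x1 * x1 * x2) + B * (x1 * x2 * x2))"
proof -
  have "ppow (fam (A, B, g, c, d)) (x1, x2) =
    (\<Sum>i<CARD('p). (A * (x1 * x1 * x2) + B * (x1 * x2 * x2)) * (of_nat i * (of_nat i + 1))
      + g * x1 * x2 * of_nat i + c * carry (of_nat i * x1) x1 + d * carry (of_nat i * x2) x2)"
    unfolding ppow_def by (intro sum.cong refl) (simp add: fam_def algebra_simps)
  then show ?thesis
    by (simp add: sum.distrib sum_carry sum_of_nat_mod_ring[OF p] eps_def[symmetric] mult.commute[of eps]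
        flip: sum_distrib_left)
qed

lemma comm_fam_inj:
  fixes A :: "'p::prime_card mod_ring"
  assumes "\<And>x y. comm (fam (A, B, g, c, d)) x y = comm (fam (A', B', g', c', d')) x y"
  shows "A = A' \<and> B = B' \<and> g = g'"
proof -
  define u v z where "u = A - A'" "v = B - B'" "z = g - g'"
  have "u - v + z = 0"
    using assms[of "(1, 0)" "(0, 1)"] by (simp add: comm_fam u_v_z_def algebra_simps)
  moreover have "u + (u - v + z) = 0"
    using assms[of "(1, 0)" "(1, 1)"] by (simp add: comm_fam u_v_z_def algebra_simps)
  moreover have "(u - v + z) - v = 0"
    using assms[of "(1, 1)" "(0, 1)"] by (simp add: comm_fam u_v_z_def algebra_simps)
  ultimately have "u = 0" "v = 0" "z = 0" by simp_all
  then show ?thesis by (simp add: u_v_z_def)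
qed

section \<open>Changes of basis and the parameters\<close>

definition lin :: "'f::comm_ring_1 \<Rightarrow> 'f \<Rightarrow> 'f \<Rightarrow> 'f \<Rightarrow> 'f \<times> 'f \<Rightarrow> 'f \<times> 'f" where
  "lin a b c d x = (a * fst x + b * snd x, c * fst x + d * snd x)"

lemma lin_add: "lin a b c d (x + y) = lin a b c d x + lin a b c d y"
  by (simp add: lin_def algebra_simps)

lemma lin_smul: "lin a b c d (smul t x) = smul t (lin a b c d x)"
  by (simp add: lin_def smul_def algebra_simps)

lemma bij_lin:
  fixes a :: "'p::prime_card mod_ring"
  assumes D: "a * d - b * c \<noteq> 0" shows "bij (lin a b c d)"
proof -
  have "inj (lin a b c d)"
  proof (rule injI)
    fix x y assume eq: "lin a b c d x = lin a b c d y"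
    define u v where "u = fst x - fst y" "v = snd x - snd y"
    have 0: "a * u + b * v = 0" "c * u + d * v = 0"
      using eq by (simp_all add: lin_def u_v_def algebra_simps)
    have "(a * d - b * c) * u = d * (a * u + b * v) - b * (c * u + d * v)"
      "(a * d - b * c) * v = a * (c * u + d * v) - c * (a * u + b * v)"
      by (simp_all add: algebra_simps)
    then have "u = 0" "v = 0" using 0 D by simp_all
    then show "x = y" by (simp add: u_v_def prod_eq_iff)
  qed
  then show ?thesis by (simp add: bij_def finite_UNIV_inj_surj)
qed

text \<open>The right action of a matrix and a central scalar \<open>k\<close>, as dictated by the
  invariants. The form with coefficients \<open>(A, - B)\<close> is pulled back and multiplied by
  \<open>k\<close> and the determinant, hence the signs; \<open>P\<close> is the p-th power map,
  evaluated at the columns of the matrix.\<close>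

definition change :: "'p::prime_card mod_ring \<Rightarrow> 'p mod_ring \<Rightarrow> 'p mod_ring \<Rightarrow> 'p mod_ring \<Rightarrow> 'p mod_ring \<Rightarrow>
    'p mod_ring \<times> 'p mod_ring \<times> 'p mod_ring \<times> 'p mod_ring \<times> 'p mod_ring \<Rightarrow>
    'p mod_ring \<times> 'p mod_ring \<times> 'p mod_ring \<times> 'p mod_ring \<times> 'p mod_ring" where
  "change m11 m12 m21 m22 k = (\<lambda>(A, B, g, c, d).
     let D = m11 * m22 - m12 * m21;
         P = (\<lambda>x1 x2. c * x1 + d * x2 + eps * (A * (x1 * x1 * x2) + B * (x1 * x2 * x2)))
     in (k * D * (A * m11 - B * m21), - (k * D * (A * m12 - B * m22)), k * D * g, k * P m11 m21, k * P m12 m22))"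

lemma comm_change:
  "comm (fam (change m11 m12 m21 m22 k w)) x y = k * comm (fam w) (lin m11 m12 m21 m22 x) (lin m11 m12 m21 m22 y)"
proof -
  obtain A B g c d where w: "w = (A, B, g, c, d)" by (metis prod.collapse)
  obtain x1 x2 y1 y2 where xy: "x = (x1, x2)" "y = (y1, y2)" by (metis prod.collapse)
  show ?thesis by (simp add: w xy change_def Let_def comm_fam lin_def) (simp add: algebra_simps)
qed

text \<open>The commutator fixes \<open>A\<close>, \<open>B\<close> and \<open>g\<close>, and the
  p-th powers at the two basis vectors fix \<open>c\<close> and \<open>d\<close>. So parameters are
  identified without rewriting any cocycle.\<close>

lemma change_unique:
  fixes w :: "'p::prime_card mod_ring \<times> 'p mod_ring \<times> 'p mod_ring \<times> 'p mod_ring \<times> 'p mod_ring"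
  assumes p: "CARD('p) > 2"
    and 1: "\<And>x y. comm (fam w') x y = k * comm (fam w) (lin m11 m12 m21 m22 x) (lin m11 m12 m21 m22 y)"
    and 2: "\<And>x. ppow (fam w') x = k * ppow (fam w) (lin m11 m12 m21 m22 x)"
  shows "w' = change m11 m12 m21 m22 k w"
proof -
  obtain A B g c d where w: "w = (A, B, g, c, d)" by (metis prod.collapse)
  obtain A' B' g' c' d' where w': "w' = (A', B', g', c', d')" by (metis prod.collapse)
  obtain A'' B'' g'' c'' d'' where w'': "change m11 m12 m21 m22 k w = (A'', B'', g'', c'', d'')"
    by (metis prod.collapse)
  have "A' = A'' \<and> B' = B'' \<and> g' = g''"
    by (rule comm_fam_inj[where c = c' and d = d' and c' = c'' and d' = d'']) (use 1 comm_change[of m11 m12 m21 m22 k w] w' w'' in simp)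
  moreover have "c' = c''"
    using 2[of "(1, 0)"] w'' by (simp add: w w' ppow_fam[OF p] lin_def change_def Let_def)
  moreover have "d' = d''"
    using 2[of "(0, 1)"] w'' by (simp add: w w' ppow_fam[OF p] lin_def change_def Let_def)
  ultimately show ?thesis by (simp add: w' w'')
qed

text \<open>The pulled-back and rescaled cocycle is Bol, so \<open>cohom_fam\<close> offers some
  parameters for it, and \<open>change_unique\<close> says which ones they are.\<close>

lemma loop_iso_change:
  fixes w :: "'p::prime_card mod_ring \<times> 'p mod_ring \<times> 'p mod_ring \<times> 'p mod_ring \<times> 'p mod_ring"
  assumes p: "CARD('p) > 2" and D: "m11 * m22 - m12 * m21 \<noteq> 0" and k: "k \<noteq> 0"
  shows "loop_iso UNIV (ext (fam w)) UNIV (ext (fam (change m11 m12 m21 m22 k w)))"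
proof -
  let ?M = "lin m11 m12 m21 m22"
  define \<theta> where "\<theta> x y = k * fam w (?M x) (?M y)" for x y
  have "bol_cocycle \<theta>"
    unfolding \<theta>_def by (intro bol_cocycle_mult bol_cocycle_comp[OF bol_cocycle_fam] lin_add)
  then obtain w' where w': "cohom \<theta> (fam w')" using cohom_fam[OF p] by blast
  have "w' = change m11 m12 m21 m22 k w"
  proof (rule change_unique[OF p])
    show "comm (fam w') x y = k * comm (fam w) (?M x) (?M y)" for x y
      using cohom_comm[OF w', of x y] by (simp add: \<theta>_def comm_def right_diff_distrib)
    show "ppow (fam w') x = k * ppow (fam w) (?M x)" for x
      using cohom_ppow[OF w', of x] by (simp add: \<theta>_def ppow_def lin_smul sum_distrib_left)
  qed
  moreover have "loop_iso UNIV (ext \<theta>) UNIV (ext (fam w))"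
  proof (rule loop_isoI[of "\<lambda>u. (?M (fst u), snd u / k)"])
    obtain N where N: "\<And>x. N (?M x) = x" "\<And>x. ?M (N x) = x"
      using bij_lin[OF D] by (metis bij_inv_eq_iff)
    show "bij (\<lambda>u. (?M (fst u), snd u / k))"
      by (rule bij_betw_byWitness[where f' = "\<lambda>u. (N (fst u), snd u * k)"]) (auto simp: N k)
  qed (simp add: ext_def lin_add \<theta>_def k add_divide_distrib)
  then have "loop_iso UNIV (ext (fam w)) UNIV (ext \<theta>)" by (rule loop_iso_sym) simp
  ultimately show ?thesis using cohom_imp_loop_iso[OF w'] loop_iso_trans by blast
qed

text \<open>This makes the fibre over 0 recognizable from the multiplication alone, so that
  isomorphisms must respect it.\<close>

lemma commutant_fam:
  fixes w :: "'p::prime_card mod_ring \<times> 'p mod_ring \<times> 'p mod_ring \<times> 'p mod_ring \<times> 'p mod_ring"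
  assumes p: "CARD('p) > 2" and w: "w = (A, B, g, c, d)" and nondeg: "(A, B, g) \<noteq> (0, 0, 0)"
    and z: "\<And>y. comm (fam w) x y = 0"
  shows "x = 0"
proof (rule ccontr)
  assume "x \<noteq> 0"
  obtain x1 x2 where x: "x = (x1, x2)" by (cases x)
  have two: "(2 :: 'p mod_ring) \<noteq> 0" using two_neq_0[OF p] .
  have z: "x1 * y2 - x2 * y1 = 0 \<or> A * (x1 + y1) - B * (x2 + y2) + g = 0" for y1 y2
    using z[of "(y1, y2)"] by (simp add: w x comm_fam)
  \<comment> \<open>The determinant with \<open>x\<close> is nonzero for \<open>y\<close>,
    \<open>y + x\<close> and \<open>2 * y\<close> alike, so the affine factor vanishes for all
    three. Differences isolate the linear form at \<open>x\<close> and at \<open>y\<close>, a basis,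
    and then \<open>g\<close>.\<close>
  have zz: "A * y1 - B * y2 = 0 \<and> A * x1 - B * x2 = 0 \<and> g = 0" if D: "x1 * y2 - x2 * y1 \<noteq> 0" for y1 y2
  proof -
    have 1: "A * (x1 + y1) - B * (x2 + y2) + g = 0" using z[of y2 y1] D by simp
    have "x1 * (y2 + x2) - x2 * (y1 + x1) \<noteq> 0" using D by (simp add: algebra_simps)
    then have "A * (x1 + (y1 + x1)) - B * (x2 + (y2 + x2)) + g = 0" using z[of "y2 + x2" "y1 + x1"] by simp
    moreover have "A * (x1 + (y1 + x1)) - B * (x2 + (y2 + x2)) + g
        = (A * (x1 + y1) - B * (x2 + y2) + g) + (A * x1 - B * x2)" by (simp add: algebra_simps)
    ultimately have 2: "A * x1 - B * x2 = 0" using 1 by simp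
    have "x1 * (2 * y2) - x2 * (2 * y1) = 2 * (x1 * y2 - x2 * y1)" by (simp add: algebra_simps)
    then have "x1 * (2 * y2) - x2 * (2 * y1) \<noteq> 0" using D two by simp
    then have "A * (x1 + 2 * y1) - B * (x2 + 2 * y2) + g = 0" using z[of "2 * y2" "2 * y1"] by simp
    moreover have "A * (x1 + 2 * y1) - B * (x2 + 2 * y2) + g
        = (A * (x1 + y1) - B * (x2 + y2) + g) + (A * y1 - B * y2)" by (simp add: algebra_simps)
    ultimately have 3: "A * y1 - B * y2 = 0" using 1 by simp
    have "A * (x1 + y1) - B * (x2 + y2) + g = (A * x1 - B * x2) + (A * y1 - B * y2) + g"
      by (simp add: algebra_simps)
    then show ?thesis using 1 2 3 by simp
  qed
  show False
  proof (cases "x1 = 0")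
    case True
    then have "x2 \<noteq> 0" using \<open>x \<noteq> 0\<close> x by (simp add: zero_prod_def)
    then show False using zz[of 0 1] nondeg True by auto
  next
    case False
    then show False using zz[of 1 0] nondeg by auto
  qed
qed

text \<open>Elements over 0 commute with everything, so by \<open>commutant_fam\<close> their images
  lie over 0. Hence \<open>f\<close> is a linear map \<open>M\<close> on the base and, on fibres, a
  scalar \<open>k\<close> plus a function \<open>h\<close> of the base point; \<open>h\<close>
  enters the comparison of cocycles only as a coboundary.\<close>

lemma loop_iso_imp_change:
  fixes w w' :: "'p::prime_card mod_ring \<times> 'p mod_ring \<times> 'p mod_ring \<times> 'p mod_ring \<times> 'p mod_ring"
  assumes p: "CARD('p) > 2" and iso: "loop_iso UNIV (ext (fam w)) UNIV (ext (fam w'))"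
    and w': "w' = (A, B, g, c, d)" "(A, B, g) \<noteq> (0, 0, 0)"
  shows "\<exists>m11 m12 m21 m22 k. m11 * m22 - m12 * m21 \<noteq> 0 \<and> k \<noteq> 0 \<and> w = change m11 m12 m21 m22 k w'"
proof -
  obtain f where f: "bij f" and hom: "\<And>u v. f (ext (fam w) u v) = ext (fam w') (f u) (f v)"
    using iso by (auto simp: loop_iso_def)
  have z: "fam w 0 x = 0" "fam w x 0 = 0" "fam w' 0 x = 0" "fam w' x 0 = 0" for x
    using bol_cocycle_zero[OF bol_cocycle_fam] by blast+
  have f0: "fst (f (0, a)) = 0" for a
  proof (rule commutant_fam[OF p w'])
    fix y
    obtain u where u: "f u = (y, 0)" using f by (metis bij_pointE)
    have "ext (fam w') (f (0, a)) (f u) = ext (fam w') (f u) (f (0, a))"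
      unfolding hom[symmetric] by (simp add: ext_def z add.commute)
    then show "comm (fam w') (fst (f (0, a))) y = 0"
      by (simp add: u ext_def comm_def algebra_simps)
  qed
  define M where "M x = fst (f (x, 0))" for x
  define h where "h x = snd (f (x, 0))" for x
  define \<kappa> where "\<kappa> a = snd (f (0, a))" for a
  have f_form: "f (x, a) = (M x, h x + \<kappa> a)" for x a
  proof -
    have "f (x, a) = f (ext (fam w) (x, 0) (0, a))" by (simp add: ext_def z)
    also have "\<dots> = (M x, h x + \<kappa> a)"
      unfolding hom by (simp add: ext_def f0 M_def h_def \<kappa>_def z)
    finally show ?thesis .
  qed
  have \<kappa>_add: "\<kappa> (a + b) = \<kappa> a + \<kappa> b" for a b
  proof -
    have "f (0, a + b) = f (ext (fam w) (0, a) (0, b))" by (simp add: ext_def z)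
    also have "\<dots> = ext (fam w') (f (0, a)) (f (0, b))" by (rule hom)
    finally show ?thesis by (simp add: \<kappa>_def ext_def f0 z)
  qed
  define k where "k = \<kappa> 1"
  have \<kappa>: "\<kappa> a = k * a" for a unfolding k_def by (rule additive_mod_ring[OF \<kappa>_add])
  have f_eq: "f u = f v \<Longrightarrow> u = v" for u v using f by (simp add: bij_def inj_eq)
  have k0: "k \<noteq> 0"
  proof
    assume "k = 0"
    then have "f (0, 1) = f (0, 0)" by (simp add: f_form \<kappa>)
    then show False using f_eq by fastforce
  qed
  have "f (ext (fam w) (x, 0) (y, 0)) = ext (fam w') (f (x, 0)) (f (y, 0))" for x y by (rule hom)
  then have M_add: "M (x + y) = M x + M y" and coh: "h (x + y) + k * fam w x y = h x + h y + fam w' (M x) (M y)"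
    for x y by (simp_all add: ext_def f_form \<kappa> \<kappa>_add)
  define m11 m21 m12 m22 where "m11 = fst (M (1, 0))" "m21 = snd (M (1, 0))"
    "m12 = fst (M (0, 1))" "m22 = snd (M (0, 1))"
  have M: "M x = lin m11 m12 m21 m22 x" for x
  proof -
    obtain x1 x2 where x: "x = (x1, x2)" by (cases x)
    have "fst (M (x1, 0)) = m11 * x1" "snd (M (x1, 0)) = m21 * x1"
      "fst (M (0, x2)) = m12 * x2" "snd (M (0, x2)) = m22 * x2"
      unfolding m11_m21_m12_m22_def
      by (rule additive_mod_ring; simp add: M_add[symmetric] flip: fst_add snd_add)+
    moreover have "M x = M (x1, 0) + M (0, x2)" by (simp add: x M_add[symmetric])
    ultimately show ?thesis by (simp add: lin_def x prod_eq_iff)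
  qed
  have M_inj: "x = 0" if "M x = 0" for x
  proof -
    have M0: "M 0 = 0" using M_add[of 0 0] by simp
    have "f (x, - h x / k) = f (0, - h 0 / k)" using that k0 by (simp add: f_form \<kappa> M0)
    then show ?thesis using f_eq by blast
  qed
  have D: "m11 * m22 - m12 * m21 \<noteq> 0"
  proof
    assume D: "m11 * m22 - m12 * m21 = 0"
    \<comment> \<open>These are the columns of the adjugate, which a singular matrix
      annihilates.\<close>
    then have "M (m22, - m21) = 0" "M (- m12, m11) = 0"
      by (simp_all add: M lin_def zero_prod_def algebra_simps)
    from this[THEN M_inj] have "m11 = 0" "m12 = 0" "m21 = 0" "m22 = 0"
      by (simp_all add: zero_prod_def)
    then have "M (1, 0) = 0" by (simp add: M lin_def zero_prod_def)
    then show False using M_inj[of "(1, 0)"] by (simp add: zero_prod_def)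
  qed
  define \<theta> where "\<theta> x y = inverse k * fam w' (M x) (M y)" for x y
  have "fam w x y = \<theta> x y + cob (\<lambda>x. - (inverse k * h x)) x y" for x y
  proof -
    have "k * fam w x y = h x + h y - h (x + y) + fam w' (M x) (M y)"
      using coh[of x y] by (simp add: algebra_simps)
    then have "inverse k * (k * fam w x y) = inverse k * (h x + h y - h (x + y) + fam w' (M x) (M y))"
      by simp
    also have "inverse k * (k * fam w x y) = fam w x y"
      unfolding mult.assoc[symmetric] left_inverse[OF k0] by simp
    finally show ?thesis by (simp add: \<theta>_def cob_def algebra_simps)
  qed
  then have coh: "cohom (fam w) \<theta>" by (auto simp: cohom_def)
  have "w = change m11 m12 m21 m22 (inverse k) w'"
  proof (rule change_unique[OF p])
    show "comm (fam w) x y = inverse k * comm (fam w') (lin m11 m12 m21 m22 x) (lin m11 m12 m21 m22 y)" for x y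
      using cohom_comm[OF coh, of x y] by (simp add: \<theta>_def comm_def M right_diff_distrib)
    show "ppow (fam w) x = inverse k * ppow (fam w') (lin m11 m12 m21 m22 x)" for x
      using cohom_ppow[OF coh, of x] by (simp add: \<theta>_def ppow_def M lin_smul sum_distrib_left)
  qed
  then show ?thesis using D k0 by (metis inverse_nonzero_iff_nonzero)
qed

section \<open>Normal forms\<close>

text \<open>The first four parameters give the noncyclic groups.  For the others the relevant
  parameter is \<open>t = d + eps\<close>, which scales by squares under changes of basis that preserve
  \<open>A = 1\<close>, \<open>B = 0\<close>, whereas for \<open>p = 3\<close> the coefficient \<open>d\<close> itself does not.\<close>

definition normal_forms :: "'p::prime_card mod_ring \<Rightarrow>
    ('p mod_ring \<times> 'p mod_ring \<times> 'p mod_ring \<times> 'p mod_ring \<times> 'p mod_ring) set" where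
  "normal_forms \<nu> = {(0, 0, 0, 0, 0), (0, 0, 0, 1, 0), (0, 0, 1, 0, 0), (0, 0, 1, 1, 0)} \<union>
    range (\<lambda>t. (1, 0, 1, 0, t - eps)) \<union> (\<lambda>t. (1, 0, 0, 0, t - eps)) ` {0, 1, \<nu>} \<union>
    {(1, 0, 0, 1, - eps), (1, 0, 1, 1, - eps)}"

lemma card_normal_forms:
  assumes "\<nu> \<noteq> 0" "\<nu> \<noteq> 1"
  shows "card (normal_forms (\<nu> :: 'p::prime_card mod_ring)) = CARD('p) + 9"
proof -
  let ?A = "{(0, 0, 0, 0, 0), (0, 0, 0, 1, 0), (0, 0, 1, 0, 0), (0, 0, 1, 1, 0)}
    :: ('p mod_ring \<times> 'p mod_ring \<times> 'p mod_ring \<times> 'p mod_ring \<times> 'p mod_ring) set"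
  let ?B = "range (\<lambda>t :: 'p mod_ring. (1 :: 'p mod_ring, 0 :: 'p mod_ring, 1 :: 'p mod_ring, 0 :: 'p mod_ring, t - eps))"
  let ?C = "(\<lambda>t. (1 :: 'p mod_ring, 0 :: 'p mod_ring, 0 :: 'p mod_ring, 0 :: 'p mod_ring, t - eps)) ` {0, 1, \<nu>}"
  let ?D = "{(1, 0, 0, 1, - eps), (1, 0, 1, 1, - eps)}
    :: ('p mod_ring \<times> 'p mod_ring \<times> 'p mod_ring \<times> 'p mod_ring \<times> 'p mod_ring) set"
  have "card ?A = 4" "card ?D = 2" by simp_all
  moreover have "card ?B = CARD('p)" by (subst card_image) (auto simp: inj_on_def)
  moreover have "card ?C = 3" by (subst card_image) (use assms in \<open>auto simp: inj_on_def\<close>)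
  moreover have "card (?A \<union> ?B \<union> ?C \<union> ?D) = card ?A + card ?B + card ?C + card ?D"
  proof -
    have A: "fst w = 0" if "w \<in> ?A" for w using that by (elim insertE emptyE) simp_all
    have B: "fst w = 1 \<and> fst (snd (snd w)) = 1 \<and> fst (snd (snd (snd w))) = 0" if "w \<in> ?B" for w
      using that by (elim rangeE) simp
    have C: "fst w = 1 \<and> fst (snd (snd w)) = 0 \<and> fst (snd (snd (snd w))) = 0" if "w \<in> ?C" for w
      using that by (elim imageE) simp
    have D: "fst w = 1 \<and> fst (snd (snd (snd w))) = 1" if "w \<in> ?D" for w
      using that by (elim insertE emptyE) simp_all
    have "?A \<inter> ?B = {}" "(?A \<union> ?B) \<inter> ?C = {}" "(?A \<union> ?B \<union> ?C) \<inter> ?D = {}"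
      by (rule equals0I, elim IntE UnE; drule A B C D; drule A B C D; simp)+
    from this[THEN card_Un_disjoint[rotated 2]] show ?thesis by (simp only: finite)
  qed
  ultimately show ?thesis by (simp add: normal_forms_def)
qed

text \<open>Keeping \<open>B = 0\<close> forces a lower triangular matrix, and \<open>A = 1\<close>
  then fixes \<open>k\<close>. Such a change sends \<open>g\<close> to \<open>g / \<alpha>\<close>,
  \<open>t\<close> to \<open>t / (\<alpha> * \<alpha>)\<close> and \<open>c\<close> to a multiple of
  \<open>c * \<alpha> + t * s\<close>. So \<open>s\<close> clears \<open>c\<close> when
  \<open>t \<noteq> 0\<close>, and \<open>\<delta>\<close> scales it to 1 when \<open>t = 0\<close>
  and \<open>c \<noteq> 0\<close>.\<close>

lemma reduce_nonassoc:
  fixes g c d \<nu> :: "'p::prime_card mod_ring"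
  assumes p: "CARD('p) > 2"
    and cl: "\<And>t. t \<noteq> 0 \<Longrightarrow> \<exists>a. a \<noteq> 0 \<and> (t = a * a \<or> t = \<nu> * (a * a))"
  shows "\<exists>w\<in>normal_forms \<nu>. loop_iso UNIV (ext (fam (1, 0, g, c, d))) UNIV (ext (fam w))"
proof -
  define t where "t = d + eps"
  have step: "loop_iso UNIV (ext (fam (1, 0, g, c, d))) UNIV
      (ext (fam (1, 0, g / \<alpha>, (c * \<alpha> + t * s) / (\<alpha> * \<alpha> * \<delta>), t / (\<alpha> * \<alpha>) - eps)))"
    if "\<alpha> \<noteq> 0" "\<delta> \<noteq> 0" for \<alpha> \<delta> s
  proof -
    define k where "k = 1 / (\<alpha> * \<alpha> * \<delta>)"
    have k: "k * (\<alpha> * \<alpha> * \<delta>) = 1" using that by (simp add: k_def)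
    have e: "eps * (\<alpha> * \<alpha>) = eps" using eps_square that by blast
    have "change \<alpha> 0 s \<delta> k (1, 0, g, c, d)
        = (k * (\<alpha> * \<alpha> * \<delta>), 0, k * (\<alpha> * \<delta>) * g, k * (c * \<alpha> + d * s + eps * (\<alpha> * \<alpha>) * s), k * (d * \<delta>))"
      by (simp add: change_def Let_def algebra_simps)
    moreover have "k * (\<alpha> * \<delta>) * g = g / \<alpha>" "k * (d * \<delta>) = d / (\<alpha> * \<alpha>)"
      using that by (simp_all add: k_def)
    moreover have "t / (\<alpha> * \<alpha>) - eps = d / (\<alpha> * \<alpha>)"
      using e that by (simp add: t_def field_simps)
    moreover have "k * (c * \<alpha> + d * s + eps * (\<alpha> * \<alpha>) * s) = (c * \<alpha> + t * s) / (\<alpha> * \<alpha> * \<delta>)"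
      unfolding e by (simp add: k_def t_def algebra_simps add_divide_distrib)
    moreover have "loop_iso UNIV (ext (fam (1, 0, g, c, d))) UNIV (ext (fam (change \<alpha> 0 s \<delta> k (1, 0, g, c, d))))"
      by (rule loop_iso_change[OF p]) (use that in \<open>auto simp: k_def\<close>)
    ultimately show ?thesis using k by simp
  qed
  show ?thesis
  proof (cases "t \<noteq> 0 \<or> c = 0")
    case True
    \<comment> \<open>For \<open>t = 0\<close> the division yields 0, and \<open>c = 0\<close> by
      the case assumption, so one formula covers both alternatives.\<close>
    have s0: "c * \<alpha> + t * (- (c * \<alpha>) / t) = 0" for \<alpha> using True by auto
    show ?thesis
    proof (cases "g = 0")
      case False
      have "loop_iso UNIV (ext (fam (1, 0, g, c, d))) UNIV (ext (fam (1, 0, 1, 0, t / (g * g) - eps)))"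
        using step[OF False, of 1 "- (c * g) / t"] False unfolding s0 by simp
      moreover have "(1, 0, 1, 0, t / (g * g) - eps) \<in> normal_forms \<nu>" by (auto simp: normal_forms_def)
      ultimately show ?thesis by blast
    next
      case g: True
      have st: "loop_iso UNIV (ext (fam (1, 0, g, c, d))) UNIV (ext (fam (1, 0, 0, 0, t / (\<alpha> * \<alpha>) - eps)))"
        if "\<alpha> \<noteq> 0" for \<alpha>
        using step[OF that, of 1 "- (c * \<alpha>) / t"] g unfolding s0 by simp
      have "\<exists>\<alpha>. \<alpha> \<noteq> 0 \<and> t / (\<alpha> * \<alpha>) \<in> {0, 1, \<nu>}"
      proof (cases "t = 0")
        case False
        then obtain a where "a \<noteq> 0" "t = a * a \<or> t = \<nu> * (a * a)" using cl by blast
        then show ?thesis by (intro exI[of _ a]) auto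
      qed (auto intro!: exI[of _ 1])
      then obtain \<alpha> where "\<alpha> \<noteq> 0" "t / (\<alpha> * \<alpha>) \<in> {0, 1, \<nu>}" by blast
      moreover from this(2) have "(1, 0, 0, 0, t / (\<alpha> * \<alpha>) - eps) \<in> normal_forms \<nu>"
        unfolding normal_forms_def by blast
      ultimately show ?thesis using st by blast
    qed
  next
    case False
    then have c: "c \<noteq> 0" and t: "t = 0" by auto
    have st: "loop_iso UNIV (ext (fam (1, 0, g, c, d))) UNIV (ext (fam (1, 0, g / \<alpha>, 1, - eps)))"
      if "\<alpha> \<noteq> 0" for \<alpha>
      using step[OF that, of "c / \<alpha>" 0] c t that by simp
    show ?thesis
    proof (cases "g = 0")
      case True
      then show ?thesis using st[of 1] by (auto simp: normal_forms_def)
    next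
      case False
      then show ?thesis using st[of g] by (auto simp: normal_forms_def)
    qed
  qed
qed

lemma reduce_normal_form:
  fixes w :: "'p::prime_card mod_ring \<times> 'p mod_ring \<times> 'p mod_ring \<times> 'p mod_ring \<times> 'p mod_ring"
    and \<nu> :: "'p mod_ring"
  assumes p: "CARD('p) > 2"
    and cl: "\<And>t. t \<noteq> 0 \<Longrightarrow> \<exists>a. a \<noteq> 0 \<and> (t = a * a \<or> t = \<nu> * (a * a))"
  shows "\<exists>w'\<in>normal_forms \<nu>. loop_iso UNIV (ext (fam w)) UNIV (ext (fam w'))"
proof -
  obtain A B g c d where w: "w = (A, B, g, c, d)" by (metis prod.collapse)
  have solve: "\<exists>v1 v2. a * v1 + b * v2 = 1" if "(a, b) \<noteq> (0, 0)" for a b :: "'p mod_ring"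
  proof (cases "a = 0")
    case True
    then show ?thesis using that by (intro exI[of _ 0] exI[of _ "1 / b"]) auto
  next
    case False
    then show ?thesis by (intro exI[of _ "1 / a"] exI[of _ 0]) auto
  qed
  show ?thesis
  proof (cases "(A, B) = (0, 0)")
    case False
    then have "(A, - B) \<noteq> (0, 0)" by auto
    then obtain v1 v2 where v: "A * v1 + - B * v2 = 1" using solve by blast
    \<comment> \<open>The first column is a vector on which the form \<open>(A, - B)\<close> takes
      the value 1, the second column \<open>(B, A)\<close> spans its kernel, and the determinant is
      that value 1.\<close>
    obtain A' B' g' c' d' where w': "change v1 B v2 A 1 w = (A', B', g', c', d')" by (metis prod.collapse)
    have D: "v1 * A - B * v2 = 1" using v by (simp add: algebra_simps)
    have "A' = (v1 * A - B * v2) * (A * v1 - B * v2)" "B' = 0"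
      using w' by (simp_all add: w change_def Let_def mult.commute[of A B])
    moreover have "A * v1 - B * v2 = 1" using v by simp
    ultimately have ch: "change v1 B v2 A 1 w = (1, 0, g', c', d')" using w' D by simp
    have "loop_iso UNIV (ext (fam w)) UNIV (ext (fam (change v1 B v2 A 1 w)))"
      by (rule loop_iso_change[OF p]) (use D in auto)
    then have iso: "loop_iso UNIV (ext (fam w)) UNIV (ext (fam (1, 0, g', c', d')))" unfolding ch .
    obtain w'' where w'': "w'' \<in> normal_forms \<nu>"
      "loop_iso UNIV (ext (fam (1, 0, g', c', d'))) UNIV (ext (fam w''))"
      using reduce_nonassoc[OF p cl] by blast
    from loop_iso_trans[OF iso w''(2)] w''(1) show ?thesis by (rule bexI)
  next
    case True
    then have AB: "A = 0" "B = 0" by auto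
    show ?thesis
    proof (cases "(c, d) = (0, 0)")
      case cd: True
      show ?thesis
      proof (cases "g = 0")
        case True
        then show ?thesis using AB cd w loop_iso_refl
          by (intro bexI[of _ w]) (auto simp: normal_forms_def)
      next
        case False
        then have "change 1 0 0 1 (1 / g) w = (0, 0, 1, 0, 0)"
          using AB cd by (simp add: w change_def Let_def)
        then have "loop_iso UNIV (ext (fam w)) UNIV (ext (fam (0, 0, 1, 0, 0 :: 'p mod_ring)))"
          using loop_iso_change[OF p, where w = w and ?m11.0 = 1 and ?m12.0 = 0 and ?m21.0 = 0 and ?m22.0 = 1 and k = "1 / g"] False
          by simp
        then show ?thesis by (intro bexI) (auto simp: normal_forms_def)
      qed
    next
      case False
      then obtain v1 v2 where v: "c * v1 + d * v2 = 1" using solve by blast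
      \<comment> \<open>The second column spans the kernel of the power map \<open>(c, d)\<close>;
        its length \<open>h\<close> becomes the determinant and is chosen to bring \<open>g\<close>
        to 0 or 1.\<close>
      define h where "h = (if g = 0 then 1 else 1 / g)"
      have h: "h \<noteq> 0" by (simp add: h_def)
      have eq: "v1 * (h * c) - - (h * d) * v2 = h * (c * v1 + d * v2)" by (simp add: algebra_simps)
      have D: "v1 * (h * c) - - (h * d) * v2 = h" unfolding eq v by simp
      have "change v1 (- (h * d)) v2 (h * c) 1 w = (0, 0, h * g, 1, 0)"
        using AB v D by (simp add: w change_def Let_def)
      then have "loop_iso UNIV (ext (fam w)) UNIV (ext (fam (0, 0, h * g, 1, 0)))"
        using loop_iso_change[OF p, where w = w and ?m11.0 = v1 and ?m12.0 = "- (h * d)" and ?m21.0 = v2 and ?m22.0 = "h * c" and k = 1] D h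
        by simp
      moreover have "h * g = 0 \<or> h * g = 1" by (simp add: h_def)
      then have "(0, 0, h * g, 1, 0) \<in> normal_forms \<nu>" by (auto simp: normal_forms_def)
      ultimately show ?thesis by blast
    qed
  qed
qed

section \<open>Distinctness of the normal forms\<close>

lemma normal_forms_cases:
  assumes "w \<in> normal_forms \<nu>"
  obtains "w = (0, 0, 0, 0, 0)" | "w = (0, 0, 0, 1, 0)" | "w = (0, 0, 1, 0, 0)" | "w = (0, 0, 1, 1, 0)"
  | g c t where "w = (1, 0, g, c, t - eps)" "g \<in> {0, 1}" "c \<in> {0, 1}" "c = 1 \<longrightarrow> t = 0" "g = 0 \<longrightarrow> t \<in> {0, 1, \<nu>}"
proof -
  consider (a) "w \<in> {(0, 0, 0, 0, 0), (0, 0, 0, 1, 0), (0, 0, 1, 0, 0), (0, 0, 1, 1, 0)}"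
    | (b) t where "w = (1, 0, 1, 0, t - eps)" | (c) t where "w = (1, 0, 0, 0, t - eps)" "t \<in> {0, 1, \<nu>}"
    | (d) "w = (1, 0, 0, 1, - eps)" | (e) "w = (1, 0, 1, 1, - eps)"
    using assms unfolding normal_forms_def by blast
  then show thesis
  proof cases
    case a
    then show thesis using that(1-4) by auto
  next
    case (b t)
    then show thesis by (intro that(5)[of 1 0 t]) auto
  next
    case (c t)
    then show thesis by (intro that(5)[of 0 0 t]) auto
  next
    case d
    then show thesis by (intro that(5)[of 0 1 0]) auto
  next
    case e
    then show thesis by (intro that(5)[of 1 1 0]) auto
  qed
qed

text \<open>When \<open>A = 1\<close> and \<open>B = 0\<close> on both sides, the matrix is lower
  triangular and \<open>k\<close> is determined, which leaves \<open>g = g' / m11\<close> and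
  \<open>t = t' / (m11 * m11)\<close>. In the remaining cases the zero pattern of the parameters
  decides.\<close>

lemma normal_form_change_unique:
  fixes w w' :: "'p::prime_card mod_ring \<times> 'p mod_ring \<times> 'p mod_ring \<times> 'p mod_ring \<times> 'p mod_ring"
  assumes nsq: "\<And>a. \<nu> \<noteq> a * a"
    and w: "w \<in> normal_forms \<nu>" and w': "w' \<in> normal_forms \<nu>"
    and w'_eq: "w' = (A, B, g', c', d')" and nondeg: "(A, B, g') \<noteq> (0, 0, 0)"
    and D: "m11 * m22 - m12 * m21 \<noteq> 0" and k: "k \<noteq> 0" and ch: "w = change m11 m12 m21 m22 k w'"
  shows "w = w'"
proof -
  define E where "E = m11 * m22 - m12 * m21"
  have E: "E \<noteq> 0" using D by (simp add: E_def)
  have kE: "k * E \<noteq> 0" using k E by simp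
  from w' show ?thesis
  proof (cases rule: normal_forms_cases)
    case 1
    then show ?thesis using nondeg w'_eq by simp
  next
    case 2
    then show ?thesis using nondeg w'_eq by simp
  next
    case 3
    then have "w = (0, 0, k * E, 0, 0)" using ch by (simp add: change_def Let_def E_def)
    with w show ?thesis using kE 3 by (cases rule: normal_forms_cases) auto
  next
    case 4
    then have w_eq: "w = (0, 0, k * E, k * m11, k * m12)" using ch by (simp add: change_def Let_def E_def)
    have "m11 \<noteq> 0 \<or> m12 \<noteq> 0" using D by auto
    with w w_eq show ?thesis using kE k 4 by (cases rule: normal_forms_cases) auto
  next
    case (5 g' c' t')
    have w_eq: "w = (k * E * m11, - (k * E * m12), k * E * g',
        k * (c' * m11 + (t' - eps) * m21 + eps * (m11 * m11 * m21)),
        k * (c' * m12 + (t' - eps) * m22 + eps * (m12 * m12 * m22)))"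
      using ch 5(1) by (simp add: change_def Let_def E_def)
    have m: "m11 \<noteq> 0 \<or> m12 \<noteq> 0" using D by auto
    from w show ?thesis
    proof (cases rule: normal_forms_cases)
      case (5 g c t)
      have m12: "m12 = 0" using w_eq 5(1) kE by simp
      have e1: "k * E * m11 = 1" using w_eq 5(1) by simp
      then have m11: "m11 \<noteq> 0" by auto
      have E_eq: "E = m11 * m22" using m12 by (simp add: E_def)
      have m22: "m22 \<noteq> 0" using E E_eq by auto
      have kk: "k = 1 / (m11 * m11 * m22)" using e1 m11 m22 by (simp add: E_eq field_simps)
      have e: "eps * (m11 * m11) = eps" using eps_square m11 by blast
      have "g = k * E * g'" using w_eq 5(1) by simp
      then have g: "g = g' / m11" using m11 m22 by (simp add: kk E_eq)
      have "t - eps = k * ((t' - eps) * m22)" using w_eq 5(1) m12 by simp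
      then have t0: "t - eps = (t' - eps) / (m11 * m11)" using m11 m22 by (simp add: kk)
      have t: "t = t' / (m11 * m11)"
      proof -
        have "(t - eps) * (m11 * m11) = t' - eps" using t0 m11 by simp
        then have "t * (m11 * m11) = t'" using e by (simp add: left_diff_distrib)
        then show ?thesis using m11 by (auto simp: eq_divide_eq)
      qed
      have "c = k * (c' * m11 + (t' - eps) * m21 + eps * (m11 * m11) * m21)"
        using w_eq 5(1) by (simp add: mult.assoc)
      then have c: "c = k * (c' * m11 + t' * m21)" unfolding e by (simp add: algebra_simps)
      have "g = g'" using g \<open>g \<in> {0, 1}\<close> \<open>g' \<in> {0, 1}\<close> m11 by auto
      \<comment> \<open>For \<open>g' = 1\<close> the entry \<open>m11\<close> must be 1, so
        \<open>t\<close> itself is invariant. For \<open>g' = 0\<close> it is known up to a nonzero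
        square, and 0, 1 and \<open>\<nu>\<close> lie in different square classes.\<close>
      moreover have tt: "t = t'"
      proof (cases "g' = 0")
        case False
        then have "m11 = 1" using g \<open>g = g'\<close> \<open>g' \<in> {0, 1}\<close> by (auto simp: field_simps)
        then show ?thesis using t by simp
      next
        case True
        then have mem: "t \<in> {0, 1, \<nu>}" "t' \<in> {0, 1, \<nu>}"
          using \<open>g = g'\<close> \<open>g = 0 \<longrightarrow> t \<in> {0, 1, \<nu>}\<close> \<open>g' = 0 \<longrightarrow> t' \<in> {0, 1, \<nu>}\<close> by auto
        have a: "t' = t * (m11 * m11)" using t m11 by simp
        have "t = 0 \<longleftrightarrow> t' = 0" using a m11 by auto
        moreover have "\<not> (t = 1 \<and> t' = \<nu>)" using a nsq[of m11] by auto
        moreover have "\<not> (t = \<nu> \<and> t' = 1)"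
          using t nsq[of "1 / m11"] by auto
        ultimately show ?thesis using mem by auto
      qed
      moreover have "c = c'"
      proof (cases "t' = 0")
        case True
        then have "c = k * c' * m11" using c by simp
        then show ?thesis using \<open>c \<in> {0, 1}\<close> \<open>c' \<in> {0, 1}\<close> k m11 by auto
      next
        case False
        then show ?thesis using tt \<open>c \<in> {0, 1}\<close> \<open>c' \<in> {0, 1}\<close> \<open>c = 1 \<longrightarrow> t = 0\<close> \<open>c' = 1 \<longrightarrow> t' = 0\<close> by auto
      qed
      ultimately show ?thesis using 5(1) \<open>w' = (1, 0, g', c', t' - eps)\<close> by simp
    qed (use w_eq kE m in auto)
  qed
qed

text \<open>This serves as the exponent invariant. Iterated right translations make sense without
  associativity or a chosen unit, and they separate abelian groups, which the commutator cannot
  distinguish.\<close>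

lemma iso_translation_power:
  assumes iso: "loop_iso A m B m'" and cl: "\<And>x y. x \<in> A \<Longrightarrow> y \<in> A \<Longrightarrow> m x y \<in> A"
    and id: "\<And>u v. u \<in> B \<Longrightarrow> v \<in> B \<Longrightarrow> ((\<lambda>x. m' x u) ^^ n) v = v"
    and u: "u \<in> A" and v: "v \<in> A"
  shows "((\<lambda>x. m x u) ^^ n) v = v"
proof -
  obtain f where f: "bij_betw f A B" and hom: "\<And>x y. x \<in> A \<Longrightarrow> y \<in> A \<Longrightarrow> f (m x y) = m' (f x) (f y)"
    using iso by (auto simp: loop_iso_def)
  have in_A: "((\<lambda>x. m x u) ^^ i) v \<in> A" for i by (induction i) (auto simp: cl u v)
  have "f (((\<lambda>x. m x u) ^^ i) v) = ((\<lambda>x. m' x (f u)) ^^ i) (f v)" for i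
    by (induction i) (auto simp: hom in_A u)
  moreover have "f u \<in> B" "f v \<in> B" using f u v by (auto simp: bij_betw_def)
  ultimately have "f (((\<lambda>x. m x u) ^^ n) v) = f v" using id by simp
  then show ?thesis using f in_A v by (auto simp: bij_betw_def dest: inj_onD)
qed

lemma ext_translation_power:
  "((\<lambda>v. ext \<theta> v u) ^^ n) v = (fst v + smul (of_nat n) (fst u),
     snd v + of_nat n * snd u + (\<Sum>i<n. \<theta> (fst v + smul (of_nat i) (fst u)) (fst u)))"
proof (induction n)
  case (Suc n)
  have "((\<lambda>v. ext \<theta> v u) ^^ Suc n) v = ext \<theta> (((\<lambda>v. ext \<theta> v u) ^^ n) v) u" by simp
  also have "\<dots> = (fst v + smul (of_nat (Suc n)) (fst u), snd v + of_nat (Suc n) * snd u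
      + (\<Sum>i<Suc n. \<theta> (fst v + smul (of_nat i) (fst u)) (fst u)))"
    unfolding Suc by (simp add: ext_def algebra_simps)
  finally show ?case .
qed simp

lemma ext_translation_power_p:
  fixes u :: "('p::prime_card mod_ring \<times> 'p mod_ring) \<times> 'p mod_ring"
  assumes "bol_cocycle \<theta>"
  shows "((\<lambda>v. ext \<theta> v u) ^^ CARD('p)) v = (fst v, snd v + ppow \<theta> (fst u))"
  using bol_cocycle_power[OF assms, where n = "CARD('p)" and x = "fst v" and y = "fst u"] bol_cocycle_zero[OF assms]
  unfolding ext_translation_power by (simp add: ppow_def)

lemma ext_translation_power_pp:
  fixes u :: "('p::prime_card mod_ring \<times> 'p mod_ring) \<times> 'p mod_ring"
  assumes "bol_cocycle \<theta>"
  shows "((\<lambda>v. ext \<theta> v u) ^^ (CARD('p) * CARD('p))) v = v"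
proof -
  have "((\<lambda>v. ext \<theta> v u) ^^ (n * CARD('p))) v = (fst v, snd v + of_nat n * ppow \<theta> (fst u))" for n
    by (induction n) (simp_all add: funpow_add ext_translation_power_p[OF assms] algebra_simps)
  then show ?thesis by simp
qed

text \<open>A nonzero commutator on either side suffices, since isomorphism is symmetric. Two forms
  with zero commutator remain, and the p-th power of a translation tells them apart.\<close>

lemma normal_forms_unique:
  fixes w w' :: "'p::prime_card mod_ring \<times> 'p mod_ring \<times> 'p mod_ring \<times> 'p mod_ring \<times> 'p mod_ring"
  assumes p: "CARD('p) > 2" and nsq: "\<And>a. \<nu> \<noteq> a * a"
    and w: "w \<in> normal_forms \<nu>" and w': "w' \<in> normal_forms \<nu>"
    and iso: "loop_iso UNIV (ext (fam w)) UNIV (ext (fam w'))"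
  shows "w = w'"
proof -
  have nd: "v = v'"
    if "v \<in> normal_forms \<nu>" "v' \<in> normal_forms \<nu>" "loop_iso UNIV (ext (fam v)) UNIV (ext (fam v'))"
      "v' = (A, B, g, c, d)" "(A, B, g) \<noteq> (0, 0, 0)" for v v' A B g c d
    using loop_iso_imp_change[OF p that(3-5)] normal_form_change_unique[OF nsq that(1,2,4,5)] by blast
  have sym: "loop_iso UNIV (ext (fam w')) UNIV (ext (fam w))"
    by (rule loop_iso_sym[OF iso]) simp
  have ne: "\<not> loop_iso UNIV (ext (fam (0, 0, 0, 1, 0 :: 'p mod_ring))) UNIV (ext (fam (0, 0, 0, 0, 0 :: 'p mod_ring)))"
  proof
    assume iso: "loop_iso UNIV (ext (fam (0, 0, 0, 1, 0 :: 'p mod_ring))) UNIV (ext (fam (0, 0, 0, 0, 0 :: 'p mod_ring)))"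
    have 0: "ppow (fam (0, 0, 0, 0, 0 :: 'p mod_ring)) x = 0" for x
      by (cases x) (simp add: ppow_fam[OF p])
    have "((\<lambda>v. ext (fam (0, 0, 0, 1, 0 :: 'p mod_ring)) v ((1, 0), 0)) ^^ CARD('p)) ((0, 0), 0) = ((0, 0), 0)"
      by (rule iso_translation_power[OF iso])
        (simp_all add: ext_translation_power_p[OF bol_cocycle_fam] 0)
    then show False by (simp add: ext_translation_power_p[OF bol_cocycle_fam] ppow_fam[OF p])
  qed
  obtain A B g c d A' B' g' c' d' where eq: "w = (A, B, g, c, d)" "w' = (A', B', g', c', d')"
    by (metis prod.collapse)
  show ?thesis
  proof (cases "(A', B', g') = (0, 0, 0) \<and> (A, B, g) = (0, 0, 0)")
    case True
    then have z: "A = 0" "B = 0" "g = 0" "A' = 0" "B' = 0" "g' = 0" by auto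
    have "w = (0, 0, 0, 0, 0) \<or> w = (0, 0, 0, 1, 0)"
      using w by (cases rule: normal_forms_cases) (use eq z in auto)
    moreover have "w' = (0, 0, 0, 0, 0) \<or> w' = (0, 0, 0, 1, 0)"
      using w' by (cases rule: normal_forms_cases) (use eq z in auto)
    ultimately show ?thesis using ne iso sym by auto
  next
    case False
    then show ?thesis
      using nd[OF w w' iso eq(2)] nd[OF w' w sym eq(1)] by auto
  qed
qed

text \<open>In every extension the \<open>p^2\<close>-th iterate of a right translation is trivial,
  whereas adding 1 that often to 0 gives \<open>p^2\<close>, which is nonzero modulo
  \<open>p^3\<close>.\<close>

lemma cyc_not_fam:
  fixes w :: "'p::prime_card mod_ring \<times> 'p mod_ring \<times> 'p mod_ring \<times> 'p mod_ring \<times> 'p mod_ring"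
  shows "\<not> loop_iso {..<CARD('p) ^ 3} (cyc (CARD('p) ^ 3)) UNIV (ext (fam w))"
proof
  let ?n = "CARD('p) ^ 3"
  assume iso: "loop_iso {..<?n} (cyc ?n) UNIV (ext (fam w))"
  have gt: "CARD('p) > 1" using prime_card[where 'a = 'p] prime_gt_1_nat by blast
  then have n: "1 < ?n" by (rule one_less_power) simp
  have "((\<lambda>x. cyc ?n x 1) ^^ i) 0 = i mod ?n" for i
    by (induction i) (simp_all add: cyc_def mod_simps)
  moreover have "((\<lambda>x. cyc ?n x 1) ^^ (CARD('p) * CARD('p))) 0 = 0"
    by (rule iso_translation_power[OF iso])
      (use n in \<open>simp_all add: ext_translation_power_pp[OF bol_cocycle_fam] cyc_def\<close>)
  moreover have "CARD('p) * CARD('p) < ?n" using gt by (simp add: power3_eq_cube)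
  ultimately show False by simp
qed

section \<open>Counting\<close>

lemma cnb_loop_cyc:
  assumes "n > 0" shows "cnb_loop {..<n} (cyc n)"
proof -
  let ?A = "{..<n}"
  have inv: "(n - a + (a + x) mod n) mod n = x" "(a + (n - a + x) mod n) mod n = x" if "a < n" "x < n" for a x
  proof -
    have "(n - a) + (a + x) = n + x" "a + (n - a + x) = n + x" using that by simp_all
    then show "(n - a + (a + x) mod n) mod n = x" "(a + (n - a + x) mod n) mod n = x"
      unfolding mod_add_right_eq using that by simp_all
  qed
  have bij: "bij_betw (\<lambda>x. (a + x) mod n) ?A ?A" if "a < n" for a
    by (rule bij_betw_byWitness[where f' = "\<lambda>x. (n - a + x) mod n"])
      (use assms inv[OF that] in auto)
  have "is_loop ?A (cyc n)"
    unfolding is_loop_def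
  proof (intro conjI ballI)
    show "\<exists>e\<in>?A. \<forall>x\<in>?A. cyc n e x = x \<and> cyc n x e = x"
      using assms by (intro bexI[of _ 0]) (auto simp: cyc_def)
    fix a assume "a \<in> ?A"
    then show "bij_betw (cyc n a) ?A ?A" "bij_betw (\<lambda>x. cyc n x a) ?A ?A"
      using bij[of a] by (simp_all add: cyc_def[abs_def] add.commute)
  qed (use assms in \<open>simp add: cyc_def\<close>)
  moreover have "right_bol ?A (cyc n)"
    by (simp add: right_bol_def cyc_def mod_simps algebra_simps)
  moreover have c: "central_mod ?A (cyc n) (Id_on ?A) c" if "c < n" for c
    using that by (auto simp: central_mod_def cyc_def Id_on_iff mod_simps ac_simps)
  have "next_cong ?A (cyc n) (Id_on ?A) = ?A \<times> ?A"
  proof (intro equalityI subrelI)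
    fix x y assume "(x, y) \<in> ?A \<times> ?A"
    then have xy: "x \<in> ?A" "y \<in> ?A" by auto
    show "(x, y) \<in> next_cong ?A (cyc n) (Id_on ?A)"
    proof (rule next_congI[OF xy])
      show "central_mod ?A (cyc n) (Id_on ?A) ((n - y + x) mod n)"
        using assms by (intro c) simp
      have "cyc n y ((n - y + x) mod n) = x"
        using xy inv(2)[of y x] by (simp add: cyc_def)
      then show "(x, cyc n y ((n - y + x) mod n)) \<in> Id_on ?A" using xy by (simp add: Id_on_iff)
    qed
  qed (auto simp: next_cong_def)
  then have "(next_cong ?A (cyc n) ^^ 1) (Id_on ?A) = ?A \<times> ?A" by simp
  then have "centrally_nilpotent ?A (cyc n)" unfolding centrally_nilpotent_def by blast
  ultimately show ?thesis by (simp add: cnb_loop_def)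
qed

lemma cn_bol_loops_alt:
  "cn_bol_loops n = {m. cnb_loop {..<n} m \<and> (\<forall>x y. x \<notin> {..<n} \<or> y \<notin> {..<n} \<longrightarrow> m x y = 0)}"
  by (simp add: cn_bol_loops_def cnb_loop_def)

lemma transport_table:
  assumes B: "cnb_loop B m'" and fin: "finite B" and card: "card B = n"
  shows "\<exists>m\<in>cn_bol_loops n. loop_iso {..<n} m B m'"
proof -
  obtain f where f: "bij_betw f {..<n} B"
    using ex_bij_betw_nat_finite[OF fin] card by (auto simp: atLeast0LessThan)
  let ?g = "the_inv_into {..<n} f"
  have inj: "inj_on f {..<n}" and fB: "f ` {..<n} = B" using f by (auto simp: bij_betw_def)
  have g: "bij_betw ?g B {..<n}" by (rule bij_betw_the_inv_into[OF f])
  have cl: "m' x y \<in> B" if "x \<in> B" "y \<in> B" for x y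
    using B that by (simp add: cnb_loop_def is_loop_def)
  have fg: "f (?g b) = b" if "b \<in> B" for b using f_the_inv_into_f[OF inj] that fB by auto
  have gB: "?g b < n" if "b \<in> B" for b using g that by (auto simp: bij_betw_def)
  define m where "m x y = (if x \<in> {..<n} \<and> y \<in> {..<n} then ?g (m' (f x) (f y)) else 0)" for x y
  have "epi B m' {..<n} m ?g"
    using g by (auto simp: epi_def bij_betw_def m_def fg gB)
  then have "cnb_loop {..<n} m" using cnb_loop_epi B fin by blast
  then have "m \<in> cn_bol_loops n" by (auto simp: cn_bol_loops_alt m_def)
  moreover have "loop_iso {..<n} m B m'"
    by (rule loop_isoI[OF f]) (use fB cl in \<open>auto simp: m_def fg\<close>)
  ultimately show ?thesis by blast
qed

lemma equiv_loop_iso_rel: "equiv (cn_bol_loops n) (loop_iso_rel n)"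
proof (rule equivI)
  show "loop_iso_rel n \<subseteq> cn_bol_loops n \<times> cn_bol_loops n" by (auto simp: loop_iso_rel_def)
  show "refl_on (cn_bol_loops n) (loop_iso_rel n)"
    by (auto simp: refl_on_def loop_iso_rel_def loop_iso_refl)
  show "sym (loop_iso_rel n)"
  proof (rule symI)
    fix a b assume ab: "(a, b) \<in> loop_iso_rel n"
    then have "a x y \<in> {..<n}" if "x \<in> {..<n}" "y \<in> {..<n}" for x y
      using that by (auto simp: loop_iso_rel_def cn_bol_loops_def is_loop_def)
    then show "(b, a) \<in> loop_iso_rel n"
      using ab loop_iso_sym[of "{..<n}" a "{..<n}" b] by (auto simp: loop_iso_rel_def)
  qed
  show "trans (loop_iso_rel n)"
    by (rule transI) (auto simp: loop_iso_rel_def intro: loop_iso_trans)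
qed

lemma card_quotient_representatives:
  assumes eq: "equiv X R" and L: "\<And>i. i \<in> I \<Longrightarrow> L i \<in> X"
    and cov: "\<And>x. x \<in> X \<Longrightarrow> \<exists>i\<in>I. (x, L i) \<in> R"
    and uniq: "\<And>i j. i \<in> I \<Longrightarrow> j \<in> I \<Longrightarrow> (L i, L j) \<in> R \<Longrightarrow> i = j"
  shows "card (X // R) = card I"
proof -
  have "bij_betw (\<lambda>i. R `` {L i}) I (X // R)"
    unfolding bij_betw_def
  proof
    show "inj_on (\<lambda>i. R `` {L i}) I"
      by (rule inj_onI) (use uniq L eq_equiv_class[OF _ eq] in blast)
    show "(\<lambda>i. R `` {L i}) ` I = X // R"
    proof (intro equalityI subsetI)
      fix c assume "c \<in> X // R"
      then obtain x where x: "x \<in> X" "c = R `` {x}" by (auto elim: quotientE)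
      then obtain i where "i \<in> I" "(x, L i) \<in> R" using cov by blast
      then show "c \<in> (\<lambda>i. R `` {L i}) ` I" using equiv_class_eq[OF eq] x by blast
    qed (use L in \<open>auto intro: quotientI\<close>)
  qed
  then show ?thesis by (metis bij_betw_same_card)
qed

lemma num_cn_bol_loops_prime_cube:
  assumes p: "CARD('p::prime_card) > 2"
  shows "num_cn_bol_loops (CARD('p) ^ 3) = CARD('p) + 10"
proof -
  let ?n = "CARD('p) ^ 3"
  let ?U = "UNIV :: (('p mod_ring \<times> 'p mod_ring) \<times> 'p mod_ring) set"
  obtain \<nu> :: "'p mod_ring" where \<nu>: "\<nu> \<noteq> 0" "\<And>a. \<nu> \<noteq> a * a"
    and cl: "\<And>t. t \<noteq> 0 \<Longrightarrow> \<exists>a. a \<noteq> 0 \<and> (t = a * a \<or> t = \<nu> * (a * a))"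
    by (rule square_classes[OF p]) (rule that)
  have \<nu>1: "\<nu> \<noteq> 1" using \<nu>(2)[of 1] by simp
  have npos: "?n > 0" by simp
  have "card ?U = ?n" by (simp add: card_prod power3_eq_cube)
  then have "\<exists>m\<in>cn_bol_loops ?n. loop_iso {..<?n} m ?U (ext (fam w))" for w
    by (intro transport_table cnb_loop_ext bol_cocycle_fam) simp_all
  then obtain F where F: "\<And>w. F w \<in> cn_bol_loops ?n" "\<And>w. loop_iso {..<?n} (F w) ?U (ext (fam w))"
    by metis
  obtain C where C: "C \<in> cn_bol_loops ?n" "loop_iso {..<?n} C {..<?n} (cyc ?n)"
    using transport_table[OF cnb_loop_cyc[OF npos]] by auto
  have closed: "m x y \<in> {..<?n}" if "m \<in> cn_bol_loops ?n" "x \<in> {..<?n}" "y \<in> {..<?n}" for m x y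
    using that by (simp add: cn_bol_loops_def is_loop_def)
  have F': "loop_iso ?U (ext (fam w)) {..<?n} (F w)" for w
    by (rule loop_iso_sym[OF F(2)]) (rule closed[OF F(1)])
  have C': "loop_iso {..<?n} (cyc ?n) {..<?n} C"
    by (rule loop_iso_sym[OF C(2)]) (rule closed[OF C(1)])
  \<comment> \<open>The index \<open>None\<close> stands for the cyclic group, the one class beyond
    the \<open>p + 9\<close> normal forms.\<close>
  define L where "L i = (case i of None \<Rightarrow> C | Some w \<Rightarrow> F w)" for i
  let ?I = "insert None (Some ` normal_forms \<nu>)"
  have CF: "\<not> loop_iso {..<?n} C {..<?n} (F w)" for w
    using cyc_not_fam[of w] loop_iso_trans[OF C'] loop_iso_trans[OF _ F(2)[of w]] by blast
  have FC: "\<not> loop_iso {..<?n} (F w) {..<?n} C" for w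
  proof
    assume "loop_iso {..<?n} (F w) {..<?n} C"
    from loop_iso_sym[OF this closed[OF F(1)]] show False using CF by blast
  qed
  have FF: "w = w'" if "w \<in> normal_forms \<nu>" "w' \<in> normal_forms \<nu>" "loop_iso {..<?n} (F w) {..<?n} (F w')" for w w'
    using normal_forms_unique[OF p \<nu>(2) that(1,2)] loop_iso_trans[OF F'[of w]]
      loop_iso_trans[OF that(3) F(2)[of w']] by blast
  have "card (cn_bol_loops ?n // loop_iso_rel ?n) = card ?I"
  proof (rule card_quotient_representatives[OF equiv_loop_iso_rel, of ?I L])
    show "L i \<in> cn_bol_loops ?n" for i by (auto simp: L_def C F split: option.split)
    show "i = j" if "i \<in> ?I" "j \<in> ?I" "(L i, L j) \<in> loop_iso_rel ?n" for i j
      using that FF CF FC by (auto simp: L_def loop_iso_rel_def)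
    fix x assume x: "x \<in> cn_bol_loops ?n"
    then have "cnb_loop {..<?n} x" by (simp add: cn_bol_loops_alt)
    then consider (cyc) "loop_iso {..<?n} x {..<?n} (cyc ?n)"
      | (ext) \<theta> :: "'p mod_ring \<times> 'p mod_ring \<Rightarrow> 'p mod_ring \<times> 'p mod_ring \<Rightarrow> 'p mod_ring"
      where "normalized \<theta>" "loop_iso {..<?n} x ?U (ext \<theta>)"
      using cnb_order_p3[of "{..<?n}" x, where 'p = 'p] by auto
    then show "\<exists>i\<in>?I. (x, L i) \<in> loop_iso_rel ?n"
    proof cases
      case cyc
      have "loop_iso {..<?n} x {..<?n} C" by (rule loop_iso_trans[OF cyc C'])
      then show ?thesis using x C by (intro bexI[of _ None]) (auto simp: L_def loop_iso_rel_def)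
    next
      case (ext \<theta>)
      obtain q where "epi {..<?n} x ?U (ext \<theta>) q" using loop_iso_imp_epi ext(2) by blast
      then have "cnb_loop ?U (ext \<theta>)" using cnb_loop_epi \<open>cnb_loop {..<?n} x\<close> by blast
      then have "bol_cocycle \<theta>"
        using ext(1) by (simp add: bol_cocycle_def cnb_loop_def right_bol_ext_iff)
      then obtain w where "cohom \<theta> (fam w)" using cohom_fam[OF p] by blast
      then have 1: "loop_iso ?U (ext \<theta>) ?U (ext (fam w))" by (rule cohom_imp_loop_iso)
      obtain w' where w': "w' \<in> normal_forms \<nu>" "loop_iso ?U (ext (fam w)) ?U (ext (fam w'))"
        using reduce_normal_form[OF p cl] by blast
      have "loop_iso {..<?n} x {..<?n} (F w')"
        by (rule loop_iso_trans[OF loop_iso_trans[OF loop_iso_trans[OF ext(2) 1] w'(2)] F'])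
      then show ?thesis using x F w' by (intro bexI[of _ "Some w'"]) (auto simp: L_def loop_iso_rel_def)
    qed
  qed
  also have "card ?I = Suc (card (normal_forms \<nu>))"
    by (subst card_insert_disjoint) (auto simp: card_image)
  also have "\<dots> = CARD('p) + 10" using card_normal_forms[OF \<nu>(1) \<nu>1] by simp
  finally show ?thesis by (simp add: num_cn_bol_loops_def)
qed

text \<open>The prime enters as the cardinality of a type, so each of the three primes needs a type
  of that size in the class \<open>prime_card\<close>.\<close>

typedef three = "{..<3 :: nat}" by (rule exI[of _ 0]) simp
typedef five = "{..<5 :: nat}" by (rule exI[of _ 0]) simp
typedef seven = "{..<7 :: nat}" by (rule exI[of _ 0]) simp

lemma CARD_three: "CARD(three) = 3" and CARD_five: "CARD(five) = 5" and CARD_seven: "CARD(seven) = 7"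
  using type_definition.card[OF type_definition_three] type_definition.card[OF type_definition_five]
    type_definition.card[OF type_definition_seven] by simp_all

instance three :: prime_card by standard (simp add: CARD_three)
instance five :: prime_card by standard (simp add: CARD_five)
instance seven :: prime_card by standard (simp add: CARD_seven)

theorem theorem5p1:
  shows "num_cn_bol_loops (3^3) = 13 \<and> num_cn_bol_loops (5^3) = 15 \<and> num_cn_bol_loops (7^3) = 17"
  using num_cn_bol_loops_prime_cube[where 'p = three] num_cn_bol_loops_prime_cube[where 'p = five]
    num_cn_bol_loops_prime_cube[where 'p = seven]
  by (simp add: CARD_three CARD_five CARD_seven)

end
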